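(* Let $G$ be an unmixed bipartite graph on the vertex set $\{x_1,\ldots,x_n\}\cup\{y_1,\ldots,y_n\}$ with $\{x_i,y_i\}\in E(G)$ for all $i$, let $\mathcal{L}_G$ be its lattice of vertex covers, and let $H_{\mathcal{L}_G}=(u_p : p\in\mathcal{L}_G)\subseteq R=K[x_1,\ldots,x_n,y_1,\ldots,y_n]$. For every $i$, all nonzero multigraded Betti numbers of $H_{\mathcal{L}_G}$ in homological degree $i$ are $i$-extremal. Moreover, a multigraded Betti number $\beta_{i,b}$ of $H_{\mathcal{L}_G}$ is extremal if and only if there exists $p\in A_G$ such that $i=|N(p)|$ and $b=\operatorname{multideg}(b(p;N(p)))$, where $\operatorname{multideg}(b(p;N(p)))$ is the exponent vector of $\operatorname{lcm}(u_p,\,u_q : q\in N(p))$.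
   Context: All graphs are finite and have no isolated vertices. A graph is unmixed if all its minimal vertex covers have the same cardinality. An unmixed bipartite graph has bipartition classes of equal size and a perfect matching, so its vertices can be labelled $x_1,\dots,x_n$ and $y_1,\dots,y_n$ (the two classes) with $\{x_i,y_i\}\in E(G)$ for all $i$; every minimal vertex cover then contains exactly one of $x_i,y_i$ for each $i$. Put $\mathcal{L}_G=\{C\cap\{x_1,\dots,x_n\} : C \text{ is a minimal vertex cover of } G\}$, viewed also as a family of subsets of $[n]$ by identifying $x_i$ with $i$. It is known that $\mathcal{L}_G$ is a sublattice of the Boolean lattice of all subsets, containing $\emptyset$ and the whole set; thus $\wedge$ is intersection and $\vee$ is union. $K$ is a field. For $p\in\mathcal{L}_G$ let $u_p=\prod_{i\in p}x_i\prod_{j\in[n]\setminus p}y_j$. $N(p)$ denotes the set of lower neighbors of $p$ in $\mathcal{L}_G$, i.e. the elements of $\mathcal{L}_G$ covered by $p$. For $N(p)=\emptyset$ the meet $\bigwedge\{r:r\in N(p)\}$ is taken to be $p$. $A_G$ is the set of all $p\in\mathcal{L}_G$ such that the interval $[\bigwedge\{r:r\in N(p)\},p]$ is a maximal Boolean lattice in $\mathcal{L}_G$, i.e. maximal with respect to inclusion among all intervals of $\mathcal{L}_G$ that are isomorphic to a Boolean lattice. (For each $p$ this interval is isomorphic to a Boolean lattice of rank $|N(p)|$.) $\beta_{i,b}=\dim_K\operatorname{Tor}_i^R(H_{\mathcal{L}_G},K)_b$ for $b\in\mathbb{Z}^{2n}$. For multidegrees, $c>b$ means $c\ge b$ componentwise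 and $c\ne b$, and $|b|$ is the sum of the entries of $b$. A nonzero $\beta_{i,b}$ is called $i$-extremal if $\beta_{i,c}=0$ for all $c>b$. A nonzero $\beta_{i,b}$ is called extremal if $\beta_{j,c}=0$ for all $j\ge i$ and all $c>b$ with $|c|-|b|\ge j-i$. *)

theory Defs
  imports Complex_Main "HOL-Library.Function_Algebras" "HOL-Library.Poly_Mapping"
begin

section \<open>Unmixed bipartite graphs and lattices of vertex covers\<close>

text \<open>The vertices are \<open>x\<^sub>i\<close> and \<open>y\<^sub>i\<close>, with labels \<open>i\<close> from a finite type that plays
  the role of \<open>[n]\<close>. Graphs are given by their edge sets; every element of the vertex type is a
  vertex.\<close>

type_synonym 'n vertex = "'n + 'n"

abbreviation xv :: "'n \<Rightarrow> 'n vertex" where "xv \<equiv> Inl"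
abbreviation yv :: "'n \<Rightarrow> 'n vertex" where "yv \<equiv> Inr"

definition simple_graph :: "'v set set \<Rightarrow> bool" where
  "simple_graph E \<longleftrightarrow> (\<forall>e\<in>E. card e = 2)"

definition no_isolated_vertices :: "'v set set \<Rightarrow> bool" where
  "no_isolated_vertices E \<longleftrightarrow> (\<forall>v. \<exists>e\<in>E. v \<in> e)"

definition bipartition :: "'v set set \<Rightarrow> 'v set \<Rightarrow> 'v set \<Rightarrow> bool" where
  "bipartition E V W \<longleftrightarrow> V \<union> W = UNIV \<and> V \<inter> W = {} \<and> (\<forall>e\<in>E. \<exists>v\<in>V. \<exists>w\<in>W. e = {v, w})"

definition vertex_cover :: "'v set set \<Rightarrow> 'v set \<Rightarrow> bool" where
  "vertex_cover E C \<longleftrightarrow> (\<forall>e\<in>E. e \<inter> C \<noteq> {})"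

definition minimal_vertex_cover :: "'v set set \<Rightarrow> 'v set \<Rightarrow> bool" where
  "minimal_vertex_cover E C \<longleftrightarrow> vertex_cover E C \<and> (\<forall>D. D \<subset> C \<longrightarrow> \<not> vertex_cover E D)"

definition unmixed :: "'v set set \<Rightarrow> bool" where
  "unmixed E \<longleftrightarrow>
    (\<forall>C D. minimal_vertex_cover E C \<longrightarrow> minimal_vertex_cover E D \<longrightarrow> card C = card D)"

definition cover_lattice :: "'n vertex set set \<Rightarrow> 'n set set" where
  "cover_lattice E = {{i. xv i \<in> C} | C. minimal_vertex_cover E C}"


section \<open>Boolean intervals\<close>

text \<open>In this section \<open>L\<close> is a sublattice of a Boolean lattice of sets, so that its order is
  inclusion and its meet is intersection.\<close>

definition lower_neighbors :: "'n set set \<Rightarrow> 'n set \<Rightarrow> 'n set set" where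
  "lower_neighbors L p = {q \<in> L. q \<subset> p \<and> \<not> (\<exists>r\<in>L. q \<subset> r \<and> r \<subset> p)}"

definition lower_meet :: "'n set set \<Rightarrow> 'n set \<Rightarrow> 'n set" where
  "lower_meet L p = (if lower_neighbors L p = {} then p else \<Inter> (lower_neighbors L p))"

definition lattice_interval :: "'n set set \<Rightarrow> 'n set \<Rightarrow> 'n set \<Rightarrow> 'n set set" where
  "lattice_interval L a b = {r \<in> L. a \<subseteq> r \<and> r \<subseteq> b}"

definition is_interval :: "'n set set \<Rightarrow> 'n set set \<Rightarrow> bool" where
  "is_interval L J \<longleftrightarrow> (\<exists>a\<in>L. \<exists>b\<in>L. a \<subseteq> b \<and> J = lattice_interval L a b)"

definition boolean_lattice :: "'n set set \<Rightarrow> bool" where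
  "boolean_lattice J \<longleftrightarrow>
    (\<exists>(k::nat) f. bij_betw f (Pow {..<k}) J \<and>
      (\<forall>S\<in>Pow {..<k}. \<forall>T\<in>Pow {..<k}. S \<subseteq> T \<longleftrightarrow> f S \<subseteq> f T))"

definition maximal_boolean_interval :: "'n set set \<Rightarrow> 'n set set \<Rightarrow> bool" where
  "maximal_boolean_interval L J \<longleftrightarrow>
    is_interval L J \<and> boolean_lattice J \<and>
    (\<forall>J'. is_interval L J' \<longrightarrow> boolean_lattice J' \<longrightarrow> J \<subseteq> J' \<longrightarrow> J' = J)"

definition max_boolean_tops :: "'n set set \<Rightarrow> 'n set set" where
  "max_boolean_tops L = {p \<in> L. maximal_boolean_interval L (lattice_interval L (lower_meet L p) p)}"


section \<open>Multigraded Betti numbers\<close>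

text \<open>The polynomial ring over \<open>'k\<close> with one variable for each element of \<open>'v\<close>.\<close>

type_synonym ('v, 'k) mpoly = "('v \<Rightarrow>\<^sub>0 nat) \<Rightarrow>\<^sub>0 'k"

definition indet :: "'v \<Rightarrow> ('v, 'k::comm_ring_1) mpoly" where
  "indet v = Poly_Mapping.single (Poly_Mapping.single v 1) 1"

definition ideal_generated :: "'r::comm_ring_1 set \<Rightarrow> 'r set" where
  "ideal_generated S = module.span (*) S"

definition homogeneous :: "('v, 'k::comm_ring_1) mpoly \<Rightarrow> ('v \<Rightarrow> int) \<Rightarrow> bool" where
  "homogeneous f a \<longleftrightarrow> (\<forall>m\<in>Poly_Mapping.keys f. \<forall>v. int (Poly_Mapping.lookup m v) = a v)"

text \<open>A complex \<open>\<dots> \<rightarrow> F\<^sub>1 \<rightarrow> F\<^sub>0 \<rightarrow> R\<close> of multigraded free modules of finite rank: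
  \<open>F\<^sub>i\<close> has a basis \<open>e\<^sub>j\<close> (\<open>j < num_gens i\<close>) with \<open>e\<^sub>j\<close> of degree \<open>gen_deg i j\<close>,
  \<open>diff_mat i k j\<close> is the coefficient of \<open>e\<^sub>k \<in> F\<^sub>i\<close> in the image of \<open>e\<^sub>j\<close>, an element of
  \<open>F\<close> in homological degree \<open>i + 1\<close>, and \<open>augm j \<in> R\<close> is the image of \<open>e\<^sub>j \<in> F\<^sub>0\<close>.\<close>

record (overloaded) ('v, 'k) free_complex =
  num_gens :: "nat \<Rightarrow> nat"
  gen_deg :: "nat \<Rightarrow> nat \<Rightarrow> 'v \<Rightarrow> int"
  diff_mat :: "nat \<Rightarrow> nat \<Rightarrow> nat \<Rightarrow> ('v, 'k) mpoly"
  augm :: "nat \<Rightarrow> ('v, 'k) mpoly"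

definition free_module :: "nat \<Rightarrow> (nat \<Rightarrow> 'r::comm_ring_1) set" where
  "free_module r = {f. \<forall>j\<ge>r. f j = 0}"

definition apply_mat ::
  "nat \<Rightarrow> nat \<Rightarrow> (nat \<Rightarrow> nat \<Rightarrow> 'r) \<Rightarrow> (nat \<Rightarrow> 'r) \<Rightarrow> (nat \<Rightarrow> 'r::comm_ring_1)" where
  "apply_mat r c A f = (\<lambda>k. if k < r then (\<Sum>j<c. A k j * f j) else 0)"

definition diff_map ::
  "('v, 'k::comm_ring_1) free_complex \<Rightarrow> nat \<Rightarrow> (nat \<Rightarrow> ('v, 'k) mpoly) \<Rightarrow> (nat \<Rightarrow> ('v, 'k) mpoly)"
  where "diff_map F i = apply_mat (num_gens F i) (num_gens F (Suc i)) (diff_mat F i)"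

definition augm_map ::
  "('v, 'k::comm_ring_1) free_complex \<Rightarrow> (nat \<Rightarrow> ('v, 'k) mpoly) \<Rightarrow> ('v, 'k) mpoly" where
  "augm_map F f = (\<Sum>j<num_gens F 0. augm F j * f j)"

definition multigraded_free_resolution ::
  "('v, 'k::comm_ring_1) free_complex \<Rightarrow> ('v, 'k) mpoly set \<Rightarrow> bool" where
  "multigraded_free_resolution F I \<longleftrightarrow>
    (\<forall>j<num_gens F 0. homogeneous (augm F j) (gen_deg F 0 j)) \<and>
    (\<forall>i. \<forall>k<num_gens F i. \<forall>j<num_gens F (Suc i).
      homogeneous (diff_mat F i k j) (gen_deg F (Suc i) j - gen_deg F i k)) \<and>
    augm_map F ` free_module (num_gens F 0) = I \<and>
    {f \<in> free_module (num_gens F 0). augm_map F f = 0} = diff_map F 0 ` free_module (num_gens F 1) \<and>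
    (\<forall>i. {f \<in> free_module (num_gens F (Suc i)). diff_map F i f = 0} =
      diff_map F (Suc i) ` free_module (num_gens F (Suc (Suc i))))"

text \<open>Tensoring with \<open>K = R/(variables)\<close> turns \<open>F\<^sub>i\<close> into \<open>K\<close> to the power \<open>num_gens i\<close>, still
  graded by the degrees of the basis elements, and replaces the entries of the differentials by
  their constant coefficients.\<close>

definition tensor_chains ::
  "('v, 'k::field) free_complex \<Rightarrow> nat \<Rightarrow> ('v \<Rightarrow> int) \<Rightarrow> (nat \<Rightarrow> 'k) set" where
  "tensor_chains F i b = {f \<in> free_module (num_gens F i). \<forall>j. f j \<noteq> 0 \<longrightarrow> gen_deg F i j = b}"

definition tensor_diff ::
  "('v, 'k::field) free_complex \<Rightarrow> nat \<Rightarrow> (nat \<Rightarrow> 'k) \<Rightarrow> (nat \<Rightarrow> 'k)" where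
  "tensor_diff F i =
    apply_mat (num_gens F i) (num_gens F (Suc i)) (\<lambda>k j. Poly_Mapping.lookup (diff_mat F i k j) 0)"

definition tensor_cycles ::
  "('v, 'k::field) free_complex \<Rightarrow> nat \<Rightarrow> ('v \<Rightarrow> int) \<Rightarrow> (nat \<Rightarrow> 'k) set" where
  "tensor_cycles F i b =
    {f \<in> tensor_chains F i b. case i of 0 \<Rightarrow> True | Suc j \<Rightarrow> tensor_diff F j f = 0}"

definition tensor_boundaries ::
  "('v, 'k::field) free_complex \<Rightarrow> nat \<Rightarrow> ('v \<Rightarrow> int) \<Rightarrow> (nat \<Rightarrow> 'k) set" where
  "tensor_boundaries F i b = tensor_diff F i ` tensor_chains F (Suc i) b"

definition dim_K :: "(nat \<Rightarrow> 'k::field) set \<Rightarrow> nat" where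
  "dim_K = vector_space.dim (\<lambda>c f j. c * f j)"

text \<open>The dimension over \<open>K\<close> of the part of degree \<open>b\<close> of \<open>Tor\<^sub>i(I, K)\<close>, the \<open>i\<close>-th homology of
  \<open>F \<otimes> K\<close> for a chosen multigraded free resolution \<open>F\<close> of \<open>I\<close>. The boundaries form a subspace
  of the finite-dimensional space of cycles, so the subtraction is the dimension of the quotient.\<close>

definition betti :: "('v, 'k::field) mpoly set \<Rightarrow> nat \<Rightarrow> ('v \<Rightarrow> int) \<Rightarrow> nat" where
  "betti I i b =
    (let F = (SOME F. multigraded_free_resolution F I)
     in dim_K (tensor_cycles F i b) - dim_K (tensor_boundaries F i b))"

text \<open>The order on multidegrees is componentwise: \<open>b < c\<close> means \<open>b \<le> c\<close> and \<open>b \<noteq> c\<close>.\<close>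

definition i_extremal :: "('v, 'k::field) mpoly set \<Rightarrow> nat \<Rightarrow> ('v \<Rightarrow> int) \<Rightarrow> bool" where
  "i_extremal I i b \<longleftrightarrow> betti I i b \<noteq> 0 \<and> (\<forall>c. c > b \<longrightarrow> betti I i c = 0)"

definition extremal :: "('v::finite, 'k::field) mpoly set \<Rightarrow> nat \<Rightarrow> ('v \<Rightarrow> int) \<Rightarrow> bool" where
  "extremal I i b \<longleftrightarrow> betti I i b \<noteq> 0 \<and>
    (\<forall>j c. j \<ge> i \<longrightarrow> c > b \<longrightarrow> sum c UNIV - sum b UNIV \<ge> int j - int i \<longrightarrow> betti I j c = 0)"


section \<open>The ideal of a lattice of vertex covers\<close>

definition cover_monomial :: "'n::finite set \<Rightarrow> ('n vertex, 'k::comm_ring_1) mpoly" where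
  "cover_monomial p = (\<Prod>i\<in>p. indet (xv i)) * (\<Prod>j\<in>- p. indet (yv j))"

definition hibi_ideal :: "'n::finite set set \<Rightarrow> ('n vertex, 'k::comm_ring_1) mpoly set" where
  "hibi_ideal L = ideal_generated (cover_monomial ` L)"

text \<open>The exponent vector of \<open>cover_monomial p\<close>; see \<open>cover_monomial_multideg\<close>.\<close>

definition cover_multideg :: "'n set \<Rightarrow> 'n vertex \<Rightarrow> int" where
  "cover_multideg p v =
    (case v of Inl i \<Rightarrow> if i \<in> p then 1 else 0 | Inr j \<Rightarrow> if j \<in> p then 0 else 1)"

lemma prod_indet:
  "finite A \<Longrightarrow> (\<Prod>a\<in>A. indet (g a) :: ('v, 'k::comm_ring_1) mpoly) =
    Poly_Mapping.single (\<Sum>a\<in>A. Poly_Mapping.single (g a) 1) 1"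
  by (induction rule: finite_induct) (auto simp: indet_def mult_single)

lemma cover_monomial_multideg:
  fixes p :: "'n::finite set"
  obtains m where "(cover_monomial p :: ('n vertex, 'k::comm_ring_1) mpoly) = Poly_Mapping.single m 1"
    and "\<And>v. int (Poly_Mapping.lookup m v) = cover_multideg p v"
proof
  let ?m = "(\<Sum>i\<in>p. Poly_Mapping.single (xv i) 1) + (\<Sum>j\<in>- p. Poly_Mapping.single (yv j) 1)"
  show "(cover_monomial p :: ('n vertex, 'k) mpoly) = Poly_Mapping.single ?m 1"
    unfolding cover_monomial_def by (simp add: prod_indet mult_single)
  show "int (Poly_Mapping.lookup ?m v) = cover_multideg p v" for v
    by (cases v) (auto simp: lookup_add lookup_sum cover_multideg_def lookup_single when_def)
qed

text \<open>The exponent vector of the least common multiple of the monomials of \<open>p\<close> and of all its lower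
  neighbors; exponents of a least common multiple of monomials are componentwise maxima.\<close>

definition lcm_multideg :: "'n::finite set set \<Rightarrow> 'n set \<Rightarrow> 'n vertex \<Rightarrow> int" where
  "lcm_multideg L p v = Max ((\<lambda>q. cover_multideg q v) ` insert p (lower_neighbors L p))"

end

(* For a lattice of sets L, the intervals of L that are Boolean lattices are the cells of a cubical
   complex: a cell (p, T) is given by its top p and a set T of blocks p - q with q a lower neighbor
   of p; its bottom is p - \<Union>T. Give (p, T) the multidegree that is the indicator of p on the
   x-variables and of the complement of the bottom on the y-variables. Then the cells of degree at
   most c are the Boolean intervals inside a fixed interval of L, and their cubical chain complex is
   acyclic: filter it by the tops; the cells with top p form the augmented chain complex of a simplex,
   which is exact unless p is the bottom of the interval. So the cubical complex gives a multigraded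
   free resolution of the ideal, and it is minimal, since faces have strictly smaller degree. By the
   comparison theorem, applied to the strands of fixed degree, beta_{i,b} is nonzero iff b is the
   degree of an i-dimensional cell. A cell contained in another one has its blocks among the blocks
   of the larger cell; hence cells of the same dimension with comparable degrees coincide, and the
   extremal Betti numbers belong to the maximal cells. *)

theory Submission
  imports Defs "HOL-Library.Countable"
begin

section \<open>Boolean intervals as cells\<close>

text \<open>\<open>betti\<close> is read off from a resolution picked by choice, so it must be shown
  that vanishing of Tor does not depend on the resolution. The comparison is made over the
  coefficients, not over polynomials. The part of degree \<open>c\<close> of a multigraded free
  module has one coordinate for each generator of degree at most \<open>c\<close>, and a homogeneous
  matrix acts on all these parts through one and the same scalar matrix. A multigraded free module
  thus becomes a free module with a degree filtration, a homogeneous map becomes a filtered linear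
  map, and tensoring with K becomes passing to graded pieces. The claims only ask which Betti
  numbers are nonzero, so it suffices to transfer the equality of cycles and boundaries; no
  isomorphism of homology has to be built. The inequality between total degrees in
  \<open>extremal\<close> is met by nested cells: the total degree of a cell is n plus the size of
  the union of its blocks, and each block has at least one element, so the gap in dimension never
  exceeds the gap in degree.\<close>

definition blocks :: "'n set set \<Rightarrow> 'n set \<Rightarrow> 'n set set" where
  "blocks L p = (\<lambda>q. p - q) ` lower_neighbors L p"

definition cells :: "'n set set \<Rightarrow> ('n set \<times> 'n set set) set" where
  "cells L = {(p, T). p \<in> L \<and> T \<subseteq> blocks L p}"

lemma mem_blocks_iff:
  "B \<in> blocks L p \<longleftrightarrow> B \<noteq> {} \<and> B \<subseteq> p \<and> p - B \<in> lower_neighbors L p"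
proof
  assume "B \<in> blocks L p"
  then obtain q where "q \<in> lower_neighbors L p" "B = p - q" by (auto simp: blocks_def)
  moreover from this have "q \<subset> p" by (simp add: lower_neighbors_def)
  ultimately show "B \<noteq> {} \<and> B \<subseteq> p \<and> p - B \<in> lower_neighbors L p"
    by (auto simp: double_diff)
next
  assume *: "B \<noteq> {} \<and> B \<subseteq> p \<and> p - B \<in> lower_neighbors L p"
  then have "B = p - (p - B)" by auto
  with * show "B \<in> blocks L p" unfolding blocks_def by blast
qed

lemma lower_neighborsD:
  assumes "q \<in> lower_neighbors L p"
  shows "q \<in> L" "q \<subset> p" "\<And>r. r \<in> L \<Longrightarrow> q \<subseteq> r \<Longrightarrow> r \<subseteq> p \<Longrightarrow> r = q \<or> r = p"
  using assms by (auto simp: lower_neighbors_def)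

lemma card_blocks: "card (blocks L p) = card (lower_neighbors L p)"
  unfolding blocks_def
  by (rule card_image, rule inj_onI) (auto dest: lower_neighborsD(2))

locale set_lattice =
  fixes L :: "'n::finite set set"
  assumes Int_closed: "p \<in> L \<Longrightarrow> q \<in> L \<Longrightarrow> p \<inter> q \<in> L"
    and Un_closed: "p \<in> L \<Longrightarrow> q \<in> L \<Longrightarrow> p \<union> q \<in> L"
begin

section \<open>Blocks of an element and faces of a cell\<close>

lemma block_diff_in: "B \<in> blocks L p \<Longrightarrow> p - B \<in> L"
  by (auto simp: mem_blocks_iff dest: lower_neighborsD)

text \<open>The union of the two lower neighbors is an element of \<open>L\<close> above both.
  Unless it is \<open>p\<close> it equals each of them, but they are distinct; so it is
  \<open>p\<close>, and the complements are disjoint.\<close>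

lemma blocks_disjoint:
  assumes "B \<in> blocks L p" "B' \<in> blocks L p" "B \<noteq> B'"
  shows "B \<inter> B' = {}"
proof -
  have B: "B \<subseteq> p" "p - B \<in> lower_neighbors L p" and B': "B' \<subseteq> p" "p - B' \<in> lower_neighbors L p"
    using assms by (auto simp: mem_blocks_iff)
  have "(p - B) \<union> (p - B') \<in> L"
    using B B' by (auto intro: Un_closed dest: lower_neighborsD)
  then have "p - B \<union> (p - B') = p - B \<or> p - B \<union> (p - B') = p"
    and "p - B \<union> (p - B') = p - B' \<or> p - B \<union> (p - B') = p"
    using lower_neighborsD(3)[OF B(2)] lower_neighborsD(3)[OF B'(2)] by blast+
  then show ?thesis using B B' assms(3) by blast
qed

text \<open>Joining \<open>s\<close> with the lower neighbor \<open>p - B\<close> stays between that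
  neighbor and \<open>p\<close>, so it adds either nothing or all of \<open>B\<close>.\<close>

lemma block_dichotomy:
  assumes "B \<in> blocks L p" "s \<in> L" "s \<subseteq> p"
  shows "B \<subseteq> s \<or> B \<inter> s = {}"
proof -
  have B: "B \<subseteq> p" "p - B \<in> lower_neighbors L p" using assms by (auto simp: mem_blocks_iff)
  have "s \<union> (p - B) \<in> L" using B assms by (auto intro: Un_closed dest: lower_neighborsD)
  then have "s \<union> (p - B) = p - B \<or> s \<union> (p - B) = p"
    using lower_neighborsD(3)[OF B(2)] assms(3) by blast
  then show ?thesis using B by blast
qed

text \<open>An element of \<open>L\<close> strictly between \<open>p - B - B'\<close> and
  \<open>p - B\<close> would split \<open>B'\<close>, contrary to the dichotomy. Faces of cells are
  cells for this reason.\<close>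

lemma blocks_shrink:
  assumes "B \<in> blocks L p" "B' \<in> blocks L p" "B \<noteq> B'"
  shows "B' \<in> blocks L (p - B)"
proof -
  have disj: "B \<inter> B' = {}" by (rule blocks_disjoint[OF assms])
  have B': "B' \<subseteq> p" "B' \<noteq> {}" using assms by (auto simp: mem_blocks_iff)
  have in1: "p - B - B' \<in> L"
    using Int_closed[OF assms(1,2)[THEN block_diff_in]]
    by (simp add: Diff_Int_distrib2 Diff_Compl Diff_eq Int_ac)
  have "r = p - B - B'" if r: "r \<in> L" "p - B - B' \<subset> r" "r \<subset> p - B" for r
  proof -
    have "B' \<subseteq> r \<or> B' \<inter> r = {}" by (rule block_dichotomy[OF assms(2)]) (use r in auto)
    then show ?thesis using r by blast
  qed
  then have "p - B - B' \<in> lower_neighbors L (p - B)"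
    using in1 disj B' unfolding lower_neighbors_def by blast
  moreover have "B' \<subseteq> p - B" using disj B' by blast
  ultimately show ?thesis using B' by (simp add: mem_blocks_iff)
qed

lemma cell_bot_in:
  assumes "(p, T) \<in> cells L"
  shows "p - \<Union>T \<in> L"
proof -
  have "finite T" by simp
  then have "p \<in> L \<Longrightarrow> T \<subseteq> blocks L p \<Longrightarrow> p - \<Union>T \<in> L"
  proof (induction T rule: finite_induct)
    case (insert B T)
    have "p - \<Union>(insert B T) = (p - B) \<inter> (p - \<Union>T)" by auto
    then show ?case using insert block_diff_in by (auto intro: Int_closed)
  qed simp
  with assms show ?thesis by (simp add: cells_def)
qed

text \<open>A cell has two facets in the direction \<open>B\<close>: the upper one keeps the top and
  raises the bottom, the lower one keeps the bottom and lowers the top. The strict changes later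
  make degrees drop.\<close>

lemma cell_face:
  assumes "(p, T) \<in> cells L" "B \<in> T"
  shows "(p, T - {B}) \<in> cells L" "(p - B, T - {B}) \<in> cells L"
    "p - B - \<Union>(T - {B}) = p - \<Union>T" "p - \<Union>T \<subseteq> p - \<Union>(T - {B})" "p - \<Union>T \<noteq> p - \<Union>(T - {B})" "p - B \<noteq> p"
proof -
  have T: "p \<in> L" "T \<subseteq> blocks L p" using assms by (auto simp: cells_def)
  then have "B \<in> blocks L p" using assms(2) by blast
  then have B: "B \<in> blocks L p" "B \<noteq> {}" "B \<subseteq> p" by (simp_all add: mem_blocks_iff)
  show "(p, T - {B}) \<in> cells L" using T by (auto simp: cells_def)
  show "(p - B, T - {B}) \<in> cells L"
    unfolding cells_def using T block_diff_in[OF B(1)] blocks_shrink[OF B(1)] by blast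
  show "p - B - \<Union>(T - {B}) = p - \<Union>T" using assms(2) by auto
  show "p - \<Union>T \<subseteq> p - \<Union>(T - {B})" by auto
  have "B \<inter> \<Union>(T - {B}) = {}" using blocks_disjoint[OF B(1)] T by blast
  then show "p - \<Union>T \<noteq> p - \<Union>(T - {B})" using B assms(2) by blast
  show "p - B \<noteq> p" using B by auto
qed

text \<open>A point of \<open>B\<close> lies in some block \<open>B'\<close> of the larger cell. The
  dichotomy for \<open>B'\<close> against \<open>p\<close> and against \<open>p - B\<close> gives
  \<open>B' \<subseteq> B\<close>; then \<open>p - B'\<close> is an element of \<open>L\<close>
  between the lower neighbor \<open>p - B\<close> and \<open>p\<close>, which forces
  equality.\<close>

lemma cell_subset:
  assumes "(p, T) \<in> cells L" "(p', T') \<in> cells L" "p \<subseteq> p'" "p' - \<Union>T' \<subseteq> p - \<Union>T"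
  shows "T \<subseteq> T'"
proof
  fix B assume "B \<in> T"
  then have B: "B \<in> blocks L p" using assms(1) by (auto simp: cells_def)
  then obtain i where i: "i \<in> B" "i \<in> p" by (auto simp: mem_blocks_iff)
  then have "i \<notin> p' - \<Union>T'" using \<open>B \<in> T\<close> assms(4) by auto
  then obtain B' where B': "B' \<in> T'" "i \<in> B'" using i assms(3) by auto
  have B'b: "B' \<in> blocks L p'" using B' assms(2) by (auto simp: cells_def)
  have "B' \<subseteq> p" using block_dichotomy[OF B'b _ assms(3)] assms(1) i B' by (auto simp: cells_def)
  moreover have "B' \<inter> (p - B) = {}"
    using block_dichotomy[OF B'b, of "p - B"] block_diff_in[OF B] assms(3) i B' by auto
  ultimately have "B' \<subseteq> B" by auto
  have "p \<inter> (p' - B') \<in> L"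
    using assms(1) block_diff_in[OF B'b] by (auto intro: Int_closed simp: cells_def)
  moreover have "p \<inter> (p' - B') = p - B'" using assms(3) by auto
  ultimately have "p - B' = p - B \<or> p - B' = p"
    using lower_neighborsD(3)[of "p - B" L p "p - B'"] B \<open>B' \<subseteq> B\<close> by (auto simp: mem_blocks_iff)
  then have "B' = B" using \<open>B' \<subseteq> B\<close> \<open>B' \<subseteq> p\<close> B' B i by (auto simp: mem_blocks_iff)
  with B' show "B \<in> T'" by simp
qed

lemma cell_eqI:
  assumes "(p, T) \<in> cells L" "(p', T') \<in> cells L" "p \<subseteq> p'" "p' - \<Union>T' \<subseteq> p - \<Union>T" "card T' \<le> card T"
  shows "p = p'" "T = T'"
proof -
  show "T = T'" using cell_subset[OF assms(1-4)] assms(5) by (simp add: card_seteq)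
  have "\<Union>T \<subseteq> p" using assms(1) by (auto simp: cells_def blocks_def)
  then show "p = p'" using assms(3,4) \<open>T = T'\<close> by blast
qed

text \<open>Blocks are disjoint and nonempty, so each block outside \<open>U\<close> adds at least
  one point. This supplies the comparison of total degrees in the definition of
  \<open>extremal\<close>.\<close>

lemma card_diff_le_card_Union:
  assumes "(p, T) \<in> cells L" "U \<subseteq> T"
  shows "int (card T) - int (card U) \<le> int (card (\<Union>T)) - int (card (\<Union>U))"
proof -
  have disj: "disjnt B B'" if "B \<in> T" "B' \<in> T" "B \<noteq> B'" for B B'
    using that assms blocks_disjoint[of B p B'] by (auto simp: cells_def disjnt_def)
  have sum: "card (\<Union>V) = (\<Sum>B\<in>V. card B)" if "V \<subseteq> T" for V
    by (rule card_Union_disjoint) (use that disj in \<open>auto simp: pairwise_def\<close>)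
  have "card B \<ge> 1" if "B \<in> T" for B
    using that assms by (auto simp: cells_def mem_blocks_iff Suc_le_eq card_gt_0_iff)
  then have "card (T - U) \<le> (\<Sum>B\<in>T - U. card B)"
    unfolding card_eq_sum[of "T - U"] by (intro sum_mono) auto
  moreover have "(\<Sum>B\<in>T. card B) = (\<Sum>B\<in>U. card B) + (\<Sum>B\<in>T - U. card B)"
    using assms(2) by (simp add: sum.subset_diff add.commute)
  moreover have "card T = card U + card (T - U)"
    using assms(2) by (simp add: card_Diff_subset card_mono)
  ultimately show ?thesis using sum[OF assms(2)] sum[OF order_refl] by linarith
qed

text \<open>The isomorphism adds to the bottom the blocks whose numbers lie in \<open>S\<close>. It
  is onto by the dichotomy: an element of the interval contains or misses each block
  entirely.\<close>

lemma boolean_interval_of_cell: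
  assumes c: "(p, T) \<in> cells L"
  shows "is_interval L (lattice_interval L (p - \<Union>T) p)"
    "boolean_lattice (lattice_interval L (p - \<Union>T) p)"
proof -
  have pT: "p \<in> L" "T \<subseteq> blocks L p" using c by (auto simp: cells_def)
  show "is_interval L (lattice_interval L (p - \<Union>T) p)"
    unfolding is_interval_def using pT cell_bot_in[OF c] by blast
  obtain e where e: "bij_betw e {..<card T} T"
    using ex_bij_betw_nat_finite[of T] by (auto simp: atLeast0LessThan)
  define f where "f S = (p - \<Union>T) \<union> \<Union>(e ` S)" for S
  have mono: "S \<subseteq> S' \<longleftrightarrow> f S \<subseteq> f S'" if "S \<subseteq> {..<card T}" "S' \<subseteq> {..<card T}" for S S'
  proof
    assume le: "f S \<subseteq> f S'"
    show "S \<subseteq> S'"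
    proof
      fix s assume s: "s \<in> S"
      then have sT: "e s \<in> T" using e that by (auto simp: bij_betw_def)
      then obtain i where i: "i \<in> e s" using pT by (fastforce simp: mem_blocks_iff)
      then have "i \<in> f S'" using le s by (auto simp: f_def)
      then obtain t where t: "t \<in> S'" "i \<in> e t" using sT i by (auto simp: f_def)
      then have tT: "e t \<in> T" using e that by (auto simp: bij_betw_def)
      have "e s = e t" using blocks_disjoint[of "e s" p "e t"] sT tT i t pT by blast
      then have "s = t" using e s t that by (blast dest: bij_betw_imp_inj_on inj_onD)
      with t show "s \<in> S'" by simp
    qed
  qed (auto simp: f_def)
  have "f ` Pow {..<card T} = lattice_interval L (p - \<Union>T) p"
  proof (intro equalityI subsetI)
    fix r assume "r \<in> f ` Pow {..<card T}"
    then obtain S where S: "S \<subseteq> {..<card T}" "r = f S" by auto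
    \<comment> \<open>Adding the blocks of \<open>S\<close> to the bottom is the same as removing
      the other blocks from the top, so the result is the bottom of a cell and lies in
      \<open>L\<close>.\<close>
    define U where "U = T - e ` S"
    have eS: "e ` S \<subseteq> T" using e S by (auto simp: bij_betw_def)
    have "r = p - \<Union>U"
    proof
      show "r \<subseteq> p - \<Union>U"
      proof
        fix i assume "i \<in> r"
        then consider "i \<in> p" "i \<notin> \<Union>T" | B where "B \<in> e ` S" "i \<in> B"
          using S(2) by (auto simp: f_def)
        then show "i \<in> p - \<Union>U"
        proof cases
          case 2
          then have "B \<in> blocks L p" using eS pT by auto
          moreover have "i \<notin> B'" if "B' \<in> U" for B'
            using blocks_disjoint[of B p B'] that 2 \<open>B \<in> blocks L p\<close> pT by (auto simp: U_def)
          ultimately show ?thesis using 2 by (auto simp: mem_blocks_iff)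
        qed (auto simp: U_def)
      qed
      show "p - \<Union>U \<subseteq> r" using S(2) by (auto simp: f_def U_def)
    qed
    moreover have "(p, U) \<in> cells L" using pT by (auto simp: cells_def U_def)
    ultimately show "r \<in> lattice_interval L (p - \<Union>T) p"
      using cell_bot_in[of p U] by (auto simp: lattice_interval_def U_def)
  next
    fix r assume r: "r \<in> lattice_interval L (p - \<Union>T) p"
    define S where "S = {s\<in>{..<card T}. e s \<subseteq> r}"
    have "f S = r"
    proof
      show "f S \<subseteq> r" using r by (auto simp: f_def S_def lattice_interval_def)
      show "r \<subseteq> f S"
      proof
        fix i assume i: "i \<in> r"
        show "i \<in> f S"
        proof (cases "i \<in> \<Union>T")
          case True
          then obtain B where B: "B \<in> T" "i \<in> B" by auto
          then obtain s where s: "s < card T" "B = e s" using e by (auto simp: bij_betw_def)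
          have "B \<subseteq> r" using block_dichotomy[of B p r] B r i pT
            by (auto simp: lattice_interval_def)
          with s B show ?thesis by (auto simp: f_def S_def)
        qed (use i r in \<open>auto simp: f_def lattice_interval_def\<close>)
      qed
    qed
    moreover have "S \<in> Pow {..<card T}" by (auto simp: S_def)
    ultimately show "r \<in> f ` Pow {..<card T}" by blast
  qed
  moreover have "inj_on f (Pow {..<card T})"
    by (intro inj_onI order_antisym) (simp_all add: mono)
  ultimately show "boolean_lattice (lattice_interval L (p - \<Union>T) p)"
    unfolding boolean_lattice_def bij_betw_def using mono
    by (intro exI[of _ "card T"] exI[of _ f]) simp
qed

text \<open>The blocks are the complements of the coatoms of the Boolean lattice. A coatom of the
  interval is also a lower neighbor of \<open>b\<close> in \<open>L\<close>, since every element of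
  \<open>L\<close> between them lies in the interval.\<close>

lemma cell_of_boolean_interval:
  assumes "a \<in> L" "b \<in> L" "a \<subseteq> b" "boolean_lattice (lattice_interval L a b)"
  obtains T where "(b, T) \<in> cells L" "b - \<Union>T = a"
proof -
  let ?J = "lattice_interval L a b"
  obtain k :: nat and f where bij: "bij_betw f (Pow {..<k}) ?J"
    and "\<forall>S\<in>Pow {..<k}. \<forall>S'\<in>Pow {..<k}. S \<subseteq> S' \<longleftrightarrow> f S \<subseteq> f S'"
    using assms(4) unfolding boolean_lattice_def by blast
  then have mono: "\<And>S S'. S \<subseteq> {..<k} \<Longrightarrow> S' \<subseteq> {..<k} \<Longrightarrow> S \<subseteq> S' \<longleftrightarrow> f S \<subseteq> f S'"
    by blast
  have fJ: "f S \<in> ?J" if "S \<subseteq> {..<k}" for S using bij that by (auto simp: bij_betw_def)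
  have fS: "\<exists>S\<subseteq>{..<k}. f S = r" if "r \<in> ?J" for r
    using that bij_betw_imp_surj_on[OF bij, symmetric] by auto
  have top: "f {..<k} = b"
  proof -
    obtain S where "S \<subseteq> {..<k}" "f S = b" using fS[of b] assms by (auto simp: lattice_interval_def)
    then have "b \<subseteq> f {..<k}" using mono[of S "{..<k}"] by auto
    then show ?thesis using fJ[of "{..<k}"] by (auto simp: lattice_interval_def)
  qed
  have bot: "f {} = a"
  proof -
    obtain S where "S \<subseteq> {..<k}" "f S = a" using fS[of a] assms by (auto simp: lattice_interval_def)
    then have "f {} \<subseteq> a" using mono[of "{}" S] by auto
    then show ?thesis using fJ[of "{}"] by (auto simp: lattice_interval_def)
  qed
  define q where "q s = f ({..<k} - {s})" for s
  have qL: "q s \<in> lower_neighbors L b" if s: "s < k" for s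
  proof -
    have qJ: "q s \<in> ?J" unfolding q_def by (rule fJ) auto
    have "\<not> b \<subseteq> q s" using mono[of "{..<k}" "{..<k} - {s}"] s by (auto simp: q_def top)
    moreover have False if r: "r \<in> L" "q s \<subset> r" "r \<subset> b" for r
    proof -
      have "r \<in> ?J" using r qJ by (auto simp: lattice_interval_def)
      then obtain S where S: "S \<subseteq> {..<k}" "f S = r" using fS by blast
      have "{..<k} - {s} \<subseteq> S" using mono[of "{..<k} - {s}" S] S r by (auto simp: q_def)
      then have "S = {..<k} - {s} \<or> S = {..<k}" using S by blast
      then show False using S r top by (auto simp: q_def)
    qed
    ultimately show ?thesis using qJ by (auto simp: lower_neighbors_def lattice_interval_def)
  qed
  define T where "T = (\<lambda>s. b - q s) ` {..<k}"
  have T: "(b, T) \<in> cells L" using assms qL by (auto simp: cells_def T_def blocks_def)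
  have "b - \<Union>T = a"
  proof -
    have "q s \<subseteq> b" if "s < k" for s using qL[OF that] by (auto dest: lower_neighborsD)
    then have eq: "x \<in> b - \<Union>T \<longleftrightarrow> x \<in> b \<and> (\<forall>s<k. x \<in> q s)" for x by (auto simp: T_def)
    have "a \<subseteq> q s" for s using fJ[of "{..<k} - {s}"] by (auto simp: q_def lattice_interval_def)
    then have "a \<subseteq> b - \<Union>T" using eq assms(3) by blast
    then have "b - \<Union>T \<in> ?J" using cell_bot_in[OF T] by (auto simp: lattice_interval_def)
    from fS[OF this] obtain S where S: "S \<subseteq> {..<k}" "f S = b - \<Union>T" by (elim exE conjE)
    \<comment> \<open>The set \<open>b - \<Union>T\<close> lies below every coatom, so its index set
      omits every number and is empty.\<close>
    have "s \<notin> S" if "s < k" for s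
    proof -
      have "f S \<subseteq> q s" using S(2) eq that by auto
      then have "S \<subseteq> {..<k} - {s}" using mono[of S "{..<k} - {s}"] S by (auto simp: q_def)
      then show ?thesis by auto
    qed
    then have "S = {}" using S by auto
    then show ?thesis using S bot by simp
  qed
  with T show thesis by (rule that)
qed

lemma lower_meet_eq: "lower_meet L p = p - \<Union>(blocks L p)"
proof (cases "lower_neighbors L p = {}")
  case False
  have "q \<subset> p" if "q \<in> lower_neighbors L p" for q using that by (auto dest: lower_neighborsD)
  with False show ?thesis by (auto simp: lower_meet_def blocks_def)
qed (simp add: lower_meet_def blocks_def)

lemma top_cell: "p \<in> L \<Longrightarrow> (p, blocks L p) \<in> cells L"
  by (simp add: cells_def)

text \<open>Intervals are compared by their end points, and every Boolean interval is the interval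
  of a cell; so maximality can be tested on cells, without reference to isomorphisms.\<close>

lemma max_boolean_tops_iff:
  "p \<in> max_boolean_tops L \<longleftrightarrow> p \<in> L \<and>
    (\<forall>p' T'. (p', T') \<in> cells L \<longrightarrow> p \<subseteq> p' \<longrightarrow> p' - \<Union>T' \<subseteq> p - \<Union>(blocks L p) \<longrightarrow>
      p' = p \<and> p' - \<Union>T' = p - \<Union>(blocks L p))"
proof (cases "p \<in> L")
  case True
  let ?r = "p - \<Union>(blocks L p)"
  have c: "(p, blocks L p) \<in> cells L" by (rule top_cell[OF True])
  have sub: "lattice_interval L ?r p \<subseteq> lattice_interval L r' p' \<longleftrightarrow> p \<subseteq> p' \<and> r' \<subseteq> ?r" for r' p'
    using True cell_bot_in[OF c] by (auto simp: lattice_interval_def)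
  have eq: "lattice_interval L r' p' = lattice_interval L ?r p \<longleftrightarrow> p' = p \<and> r' = ?r"
    if "r' \<in> L" "p' \<in> L" "r' \<subseteq> p'" for r' p'
  proof
    assume J: "lattice_interval L r' p' = lattice_interval L ?r p"
    have "r' \<in> lattice_interval L ?r p" "p' \<in> lattice_interval L ?r p"
      unfolding J[symmetric] using that by (auto simp: lattice_interval_def)
    then show "p' = p \<and> r' = ?r" using sub[of r' p'] J by (auto simp: lattice_interval_def)
  qed simp
  have "p \<in> max_boolean_tops L \<longleftrightarrow>
      (\<forall>J'. is_interval L J' \<longrightarrow> boolean_lattice J' \<longrightarrow> lattice_interval L ?r p \<subseteq> J' \<longrightarrow>
        J' = lattice_interval L ?r p)"
    unfolding max_boolean_tops_def maximal_boolean_interval_def lower_meet_eq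
    using True boolean_interval_of_cell[OF c] by blast
  also have "\<dots> \<longleftrightarrow> (\<forall>p' T'. (p', T') \<in> cells L \<longrightarrow> p \<subseteq> p' \<longrightarrow> p' - \<Union>T' \<subseteq> ?r \<longrightarrow>
      p' = p \<and> p' - \<Union>T' = ?r)" (is "?lhs = ?rhs")
  proof
    assume max: ?lhs
    show ?rhs
    proof (intro allI impI)
      fix p' T' assume c': "(p', T') \<in> cells L" and le: "p \<subseteq> p'" "p' - \<Union>T' \<subseteq> ?r"
      have "lattice_interval L (p' - \<Union>T') p' = lattice_interval L ?r p"
        using max boolean_interval_of_cell[OF c'] sub le by simp
      then show "p' = p \<and> p' - \<Union>T' = ?r"
        using eq[of "p' - \<Union>T'" p'] cell_bot_in[OF c'] c' by (auto simp: cells_def)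
    qed
  next
    assume max: ?rhs
    show ?lhs
    proof (intro allI impI)
      fix J' assume J': "is_interval L J'" "boolean_lattice J'" "lattice_interval L ?r p \<subseteq> J'"
      obtain a b where ab: "a \<in> L" "b \<in> L" "a \<subseteq> b" "J' = lattice_interval L a b"
        using J'(1) by (auto simp: is_interval_def)
      obtain T' where T': "(b, T') \<in> cells L" "b - \<Union>T' = a"
        using cell_of_boolean_interval[OF ab(1-3)] J'(2) ab(4) by blast
      have "p \<subseteq> b" "a \<subseteq> ?r" using J'(3) sub ab(4) by auto
      then have "b = p" "a = ?r" using max T' by blast+
      with ab show "J' = lattice_interval L ?r p" by simp
    qed
  qed
  finally show ?thesis using True by simp
qed (simp add: max_boolean_tops_def)

end


section \<open>Acyclicity of the cubical complex\<close>

text \<open>The usual alternating sign of a face of a cube. Blocks have no natural linear order, so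
  the position of \<open>B\<close> in \<open>T\<close> is measured by the numbering
  \<open>to_nat\<close>.\<close>

definition cell_sign :: "'n::finite set set \<Rightarrow> 'n set \<Rightarrow> 'k::comm_ring_1" where
  "cell_sign T B = (- 1) ^ card {B' \<in> T. to_nat B' < to_nat B}"

definition unit_chain :: "'c \<Rightarrow> 'c \<Rightarrow> 'k::comm_ring_1" where
  "unit_chain x = (\<lambda>y. if y = x then 1 else 0)"

text \<open>The signed boundary of a cube, each direction contributing its upper facet minus its
  lower one.\<close>

definition cell_bd :: "'n::finite set \<times> 'n set set \<Rightarrow> 'n set \<times> 'n set set \<Rightarrow> 'k::comm_ring_1" where
  "cell_bd x y = (\<Sum>B\<in>snd x. cell_sign (snd x) B *
     (unit_chain (fst x, snd x - {B}) y - unit_chain (fst x - B, snd x - {B}) y))"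

definition cell_diff :: "'n::finite set set \<Rightarrow> ('n set \<times> 'n set set \<Rightarrow> 'k) \<Rightarrow>
    'n set \<times> 'n set set \<Rightarrow> 'k::comm_ring_1" where
  "cell_diff L a = (\<lambda>y. \<Sum>x\<in>cells L. a x * cell_bd x y)"

definition cell_aug :: "'n::finite set set \<Rightarrow> ('n set \<times> 'n set set \<Rightarrow> 'k) \<Rightarrow> 'k::comm_ring_1" where
  "cell_aug L a = (\<Sum>x\<in>{x \<in> cells L. snd x = {}}. a x)"

text \<open>The end points may be arbitrary sets outside the lattice, because they will be read off
  from a multidegree.\<close>

definition interval_cells :: "'n set set \<Rightarrow> 'n set \<Rightarrow> 'n set \<Rightarrow> nat \<Rightarrow> ('n set \<times> 'n set set) set" where
  "interval_cells L lo hi m =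
    {x \<in> cells L. lo \<subseteq> fst x - \<Union>(snd x) \<and> fst x \<subseteq> hi \<and> card (snd x) = m}"

section \<open>Signs and the vanishing of the boundary of a boundary\<close>

lemma cell_sign_square [simp]: "cell_sign T B * cell_sign T B = 1"
  by (simp add: cell_sign_def)

text \<open>Removing the later of the two blocks leaves the position of the earlier one alone, while
  removing the earlier one shifts the later one by one place.\<close>

lemma cell_sign_antisym:
  assumes "B \<in> T" "B' \<in> T" "B \<noteq> B'"
  shows "cell_sign T B * cell_sign (T - {B}) B' = - (cell_sign T B' * cell_sign (T - {B'}) B :: 'k::comm_ring_1)"
proof -
  have *: "cell_sign T B * cell_sign (T - {B}) B' = - (cell_sign T B' * cell_sign (T - {B'}) B :: 'k)"
    if "B \<in> T" "B' \<in> T" "to_nat B < to_nat B'" for B B'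
  proof -
    have "{C \<in> T - {B'}. to_nat C < to_nat B} = {C \<in> T. to_nat C < to_nat B}" using that by auto
    then have "cell_sign (T - {B'}) B = (cell_sign T B :: 'k)" by (simp add: cell_sign_def)
    moreover have "{C \<in> T. to_nat C < to_nat B'} = insert B {C \<in> T - {B}. to_nat C < to_nat B'}"
      using that by auto
    then have "cell_sign T B' = (- cell_sign (T - {B}) B' :: 'k)" by (simp add: cell_sign_def)
    ultimately show ?thesis by (simp add: mult.commute)
  qed
  have "to_nat B < to_nat B' \<or> to_nat B' < to_nat B"
    using assms(3) by (metis injD inj_to_nat linorder_neqE_nat)
  then show ?thesis using *[of B B'] *[of B' B] assms by auto
qed

text \<open>The terms cancel in pairs. Peeling off one element at a time avoids concluding that a
  sum equal to its negative is zero, which fails in characteristic 2.\<close>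

lemma sum_off_diagonal_antisym:
  fixes h :: "'a \<Rightarrow> 'a \<Rightarrow> 'k::comm_ring_1"
  assumes "finite A" "\<And>x y. x \<in> A \<Longrightarrow> y \<in> A \<Longrightarrow> x \<noteq> y \<Longrightarrow> h x y = - h y x"
  shows "(\<Sum>x\<in>A. \<Sum>y\<in>A - {x}. h x y) = 0"
  using assms
proof (induction A rule: finite_induct)
  case (insert z A)
  have "(\<Sum>x\<in>insert z A. \<Sum>y\<in>insert z A - {x}. h x y) =
      (\<Sum>y\<in>A. h z y) + (\<Sum>x\<in>A. \<Sum>y\<in>insert z (A - {x}). h x y)"
  proof -
    have "insert z A - {z} = A" using insert.hyps by auto
    moreover have "insert z A - {x} = insert z (A - {x})" if "x \<in> A" for x
      using that insert.hyps by auto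
    ultimately show ?thesis using insert.hyps by (simp cong: sum.cong)
  qed
  also have "\<dots> = (\<Sum>y\<in>A. h z y) + (\<Sum>x\<in>A. h x z + (\<Sum>y\<in>A - {x}. h x y))"
    using insert.hyps by (simp cong: sum.cong)
  also have "\<dots> = (\<Sum>y\<in>A. h z y + h y z)"
  proof -
    have "(\<Sum>x\<in>A. \<Sum>y\<in>A - {x}. h x y) = 0"
      by (rule insert.IH) (rule insert.prems, auto)
    then show ?thesis by (simp add: sum.distrib)
  qed
  also have "\<dots> = 0"
  proof (rule sum.neutral, rule ballI)
    fix y assume "y \<in> A"
    with insert.hyps have "h z y = - h y z" by (intro insert.prems) auto
    then show "h z y + h y z = 0" by simp
  qed
  finally show ?case .
qed simp

lemma cell_bd_nonzeroD:
  assumes "cell_bd (p, T) (q, U) \<noteq> (0::'k::comm_ring_1)"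
  obtains B where "B \<in> T" "U = T - {B}" "q = p \<or> q = p - B"
proof -
  obtain B where "B \<in> T"
    "cell_sign T B * (unit_chain (p, T - {B}) (q, U) - unit_chain (p - B, T - {B}) (q, U)) \<noteq> (0::'k)"
    using assms unfolding cell_bd_def by (auto elim!: sum.not_neutral_contains_not_neutral)
  with that show ?thesis by (auto simp: unit_chain_def split: if_splits)
qed

lemma cell_diff_add: "cell_diff L (\<lambda>x. a x + b x) y = cell_diff L a y + cell_diff L b y"
  by (simp add: cell_diff_def sum.distrib algebra_simps)

lemma cell_diff_minus: "cell_diff L (\<lambda>x. a x - b x) y = cell_diff L a y - cell_diff L b y"
  by (simp add: cell_diff_def sum_subtractf algebra_simps)

lemma cell_diff_scale: "cell_diff L (\<lambda>x. c * a x) y = c * cell_diff L a y"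
  by (simp add: cell_diff_def sum_distrib_left mult.assoc)

lemma cell_diff_sum: "cell_diff L (\<lambda>x. \<Sum>i\<in>I. f i x) y = (\<Sum>i\<in>I. cell_diff L (f i) y)"
  unfolding cell_diff_def sum_distrib_right by (rule sum.swap)

lemma cell_diff_unit:
  assumes "x \<in> cells L"
  shows "cell_diff L (unit_chain x) y = cell_bd x y"
proof -
  have "cell_diff L (unit_chain x) y = (\<Sum>z\<in>cells L. if z = x then cell_bd z y else 0)"
    unfolding cell_diff_def unit_chain_def by (rule sum.cong) auto
  then show ?thesis using assms by simp
qed

context set_lattice begin

lemma cell_diff_bd:
  assumes "x \<in> cells L"
  shows "cell_diff L (cell_bd x) y = (0::'k::comm_ring_1)"
proof -
  obtain p T where x: "x = (p, T)" by (cases x)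
  \<comment> \<open>\<open>K B B'\<close> collects the four faces of codimension two in the
    directions \<open>B\<close> and \<open>B'\<close>. It is symmetric in them, while the product of
    signs is antisymmetric.\<close>
  define K :: "'n set \<Rightarrow> 'n set \<Rightarrow> 'k" where "K B B' =
    unit_chain (p, T - {B} - {B'}) y - unit_chain (p - B', T - {B} - {B'}) y -
    (unit_chain (p - B, T - {B} - {B'}) y - unit_chain (p - B - B', T - {B} - {B'}) y)" for B B'
  have "cell_diff L (cell_bd x) y = (\<Sum>B\<in>T. cell_sign T B *
      (cell_diff L (unit_chain (p, T - {B})) y - cell_diff L (unit_chain (p - B, T - {B})) y))"
    unfolding x cell_bd_def fst_conv snd_conv by (simp add: cell_diff_sum cell_diff_scale cell_diff_minus)
  also have "\<dots> = (\<Sum>B\<in>T. cell_sign T B * (cell_bd (p, T - {B}) y - cell_bd (p - B, T - {B}) y))"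
    by (rule sum.cong) (use assms x cell_face in \<open>auto simp: cell_diff_unit\<close>)
  also have "\<dots> = (\<Sum>B\<in>T. \<Sum>B'\<in>T - {B}. (cell_sign T B * cell_sign (T - {B}) B') * K B B')"
    by (rule sum.cong) (auto simp: cell_bd_def K_def sum_distrib_left simp flip: sum_subtractf
      intro!: sum.cong, auto simp: algebra_simps)
  also have "\<dots> = 0"
  proof (rule sum_off_diagonal_antisym)
    fix B B' assume B: "B \<in> T" "B' \<in> T" "B \<noteq> B'"
    have "T - {B} - {B'} = T - {B'} - {B}" "p - B - B' = p - B' - B" by auto
    then have "K B B' = K B' B" by (simp add: K_def)
    then show "cell_sign T B * cell_sign (T - {B}) B' * K B B' =
        - (cell_sign T B' * cell_sign (T - {B'}) B * K B' B)"
      by (simp add: cell_sign_antisym[OF B])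
  qed simp
  finally show ?thesis .
qed

lemma cell_diff_diff: "cell_diff L (cell_diff L a) y = (0::'k::comm_ring_1)"
proof -
  have "cell_diff L (cell_diff L a) y = (\<Sum>x\<in>cells L. a x * cell_diff L (cell_bd x) y)"
    by (simp add: cell_diff_def[of L a] cell_diff_sum cell_diff_scale)
  then show ?thesis by (simp add: cell_diff_bd cong: sum.cong)
qed

text \<open>The two facets in one direction have the same blocks, so both or neither are vertices,
  and they cancel under the augmentation.\<close>

lemma cell_aug_diff: "cell_aug L (cell_diff L a) = (0::'k::comm_ring_1)"
proof -
  have "cell_aug L (cell_bd x) = (0::'k)" if x: "x \<in> cells L" for x
  proof -
    obtain p T where pT: "x = (p, T)" by (cases x)
    have unit: "cell_aug L (unit_chain z) = (if snd z = {} then 1 else 0 :: 'k)" if "z \<in> cells L" for z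
      using that by (auto simp: cell_aug_def unit_chain_def sum.delta)
    have "cell_aug L (cell_bd x) = (\<Sum>B\<in>T. cell_sign T B *
        (cell_aug L (unit_chain (p, T - {B})) - cell_aug L (unit_chain (p - B, T - {B})) :: 'k))"
      unfolding pT cell_bd_def cell_aug_def fst_conv snd_conv
      by (subst sum.swap) (simp add: right_diff_distrib sum_subtractf sum_distrib_left)
    also have "\<dots> = 0"
      by (rule sum.neutral) (use x pT cell_face in \<open>auto simp: unit\<close>)
    finally show ?thesis .
  qed
  moreover have "cell_aug L (cell_diff L a) = (\<Sum>x\<in>cells L. a x * cell_aug L (cell_bd x))"
    unfolding cell_aug_def cell_diff_def sum_distrib_left by (rule sum.swap)
  ultimately show ?thesis by simp
qed

section \<open>Supports of chains and exactness on an interval\<close>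

lemma interval_cells_face:
  assumes "x \<in> interval_cells L lo hi (Suc m)" "cell_bd x y \<noteq> (0::'k::comm_ring_1)"
  shows "y \<in> interval_cells L lo hi m" "fst y \<subseteq> fst x"
proof -
  obtain p T q U where xy: "x = (p, T)" "y = (q, U)" by (cases x, cases y)
  then obtain B where B: "B \<in> T" "U = T - {B}" "q = p \<or> q = p - B"
    using assms(2) cell_bd_nonzeroD by metis
  have c: "(p, T) \<in> cells L" and lo: "lo \<subseteq> p - \<Union>T" and hi: "p \<subseteq> hi" "card T = Suc m"
    using assms(1) xy by (auto simp: interval_cells_def)
  have "(q, U) \<in> cells L" "p - \<Union>T \<subseteq> q - \<Union>U"
    using B(2,3) cell_face(1-4)[OF c B(1)] by auto
  moreover have "card U = m" using B hi by simp
  moreover have "q \<subseteq> p" using B by auto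
  ultimately show "y \<in> interval_cells L lo hi m" "fst y \<subseteq> fst x"
    using order_trans[OF lo] order_trans[OF _ hi(1)] xy by (simp_all add: interval_cells_def)
qed

lemma cell_diff_interval_cells:
  assumes "\<And>x. a x \<noteq> 0 \<Longrightarrow> x \<in> interval_cells L lo hi (Suc m)" "cell_diff L a y \<noteq> (0::'k::comm_ring_1)"
  obtains x where "a x \<noteq> 0" "y \<in> interval_cells L lo hi m" "fst y \<subseteq> fst x"
proof -
  obtain x where "a x * cell_bd x y \<noteq> 0"
    using assms(2) unfolding cell_diff_def by (auto elim!: sum.not_neutral_contains_not_neutral)
  then have "a x \<noteq> 0" "cell_bd x y \<noteq> (0::'k)" by auto
  with that show thesis using assms(1) interval_cells_face by blast
qed

lemma cell_diff_single:
  assumes "z \<in> cells L" "\<And>x. x \<in> cells L \<Longrightarrow> x \<noteq> z \<Longrightarrow> a x * cell_bd x y = 0"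
  shows "cell_diff L a y = a z * cell_bd z y"
proof -
  have "cell_diff L a y = (\<Sum>x\<in>{z}. a x * cell_bd x y)"
    unfolding cell_diff_def by (rule sum.mono_neutral_right) (use assms in auto)
  then show ?thesis by simp
qed

text \<open>Only the upper facet in the direction \<open>B\<close> has top \<open>p\<close> and
  blocks \<open>T - {B}\<close>: lower facets have a smaller top, and different directions leave
  different sets of blocks.\<close>

lemma cell_bd_top_face:
  assumes "(p, T) \<in> cells L" "B \<in> T"
  shows "cell_bd (p, T) (p, T - {B}) = (cell_sign T B :: 'k::comm_ring_1)"
proof -
  have "p \<noteq> p - C" if "C \<in> T" for C using cell_face(6)[OF assms(1) that] by simp
  moreover have "T - {B} = T - {C} \<longleftrightarrow> C = B" if "C \<in> T" for C using assms(2) that by auto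
  ultimately have "cell_bd (p, T) (p, T - {B}) = (\<Sum>C\<in>T. if C = B then cell_sign T B else 0 :: 'k)"
    unfolding cell_bd_def by (intro sum.cong) (auto simp: unit_chain_def)
  then show ?thesis using assms(2) by simp
qed

text \<open>\<open>D\<close> is a down-closed set of tops carrying the support of \<open>a\<close>;
  the induction removes a maximal element \<open>p\<close> of it. Subtracting the boundary of a
  chain with top \<open>p\<close> clears all coefficients at \<open>p\<close>, and the other tops
  this boundary reaches are smaller, hence still in \<open>D\<close>.\<close>

lemma cell_complex_exact_aux:
  fixes a :: "'n set \<times> 'n set set \<Rightarrow> 'k::comm_ring_1"
  assumes "D \<subseteq> lattice_interval L lo hi"
    and "\<And>p q. p \<in> D \<Longrightarrow> q \<in> lattice_interval L lo hi \<Longrightarrow> q \<subseteq> p \<Longrightarrow> q \<in> D"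
    and "\<And>x. a x \<noteq> 0 \<Longrightarrow> x \<in> interval_cells L lo hi m \<and> fst x \<in> D"
    and "if m = 0 then cell_aug L a = 0 else \<forall>y. cell_diff L a y = 0"
  shows "\<exists>b. (\<forall>x. b x \<noteq> 0 \<longrightarrow> x \<in> interval_cells L lo hi (Suc m)) \<and> (\<forall>y. cell_diff L b y = a y)"
  using assms
proof (induction "card D" arbitrary: D a rule: less_induct)
  case less
  note D = less.prems(1) and down = less.prems(2) and supp = less.prems(3) and cyc = less.prems(4)
  show ?case
  proof (cases "\<forall>x. a x = 0")
    case True
    then show ?thesis by (intro exI[of _ "\<lambda>_. 0"]) (simp add: cell_diff_def)
  next
    case False
    then have "D \<noteq> {}" using supp by auto
    then obtain p where p: "p \<in> D" "\<And>q. q \<in> D \<Longrightarrow> p \<subseteq> q \<Longrightarrow> q = p"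
      using finite_has_maximal[of D] by (metis finite)
    have pI: "p \<in> L" "lo \<subseteq> p" "p \<subseteq> hi" using p(1) D by (auto simp: lattice_interval_def)
    define R where "R = {r \<in> lattice_interval L lo hi. r \<subset> p}"
    have "R \<noteq> {}"
    proof
      \<comment> \<open>Then \<open>p\<close> is the least element of the interval, every cell in
        the support is the vertex \<open>p\<close>, and the vanishing of the augmentation kills its
        coefficient.\<close>
      assume "R = {}"
      have min: "p \<subseteq> r" if "r \<in> lattice_interval L lo hi" for r
      proof -
        have "p \<inter> r \<in> lattice_interval L lo hi"
          using that pI by (auto simp: lattice_interval_def intro: Int_closed)
        then show ?thesis using \<open>R = {}\<close> by (auto simp: R_def)
      qed
      have only: "x = (p, {}) \<and> m = 0" if "a x \<noteq> 0" for x
      proof -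
        obtain q T where x: "x = (q, T)" by (cases x)
        have q: "q = p" using supp[OF that] x p(2) min D by auto
        have c: "(p, T) \<in> cells L" and lo: "lo \<subseteq> p - \<Union>T" and m: "card T = m"
          using supp[OF that] x q by (auto simp: interval_cells_def)
        have "p - \<Union>T \<in> lattice_interval L lo hi"
          using cell_bot_in[OF c] lo pI by (auto simp: lattice_interval_def)
        then have "p \<subseteq> p - \<Union>T" by (rule min)
        have "T = {}"
        proof (rule ccontr)
          assume "T \<noteq> {}"
          then obtain B where "B \<in> T" by blast
          then have "B \<in> blocks L p" using c by (auto simp: cells_def)
          then have "B \<noteq> {}" "B \<subseteq> p" by (simp_all add: mem_blocks_iff)
          then show False using \<open>B \<in> T\<close> \<open>p \<subseteq> p - \<Union>T\<close> by blast
        qed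
        then show ?thesis using x q m by simp
      qed
      then have "m = 0" using False by blast
      have "cell_aug L a = (\<Sum>x\<in>{(p, {})}. a x)"
        unfolding cell_aug_def by (rule sum.mono_neutral_right) (use only pI in \<open>auto simp: cells_def\<close>)
      then have "a (p, {}) = 0" using cyc \<open>m = 0\<close> by simp
      then show False using False only by metis
    qed
    then obtain r where r: "r \<in> R" "\<And>s. s \<in> R \<Longrightarrow> r \<subseteq> s \<Longrightarrow> s = r"
      using finite_has_maximal[of R] by (metis finite)
    then have rI: "r \<in> L" "lo \<subseteq> r" "r \<subseteq> hi" "r \<subset> p" by (auto simp: R_def lattice_interval_def)
    have "r \<in> lower_neighbors L p"
    proof -
      have False if "s \<in> L" "r \<subset> s" "s \<subset> p" for s
      proof -
        have "s \<in> R" using that rI pI by (auto simp: R_def lattice_interval_def)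
        then show False using r(2)[of s] that by auto
      qed
      then show ?thesis using rI by (auto simp: lower_neighbors_def)
    qed
    txt \<open>The cells with top \<open>p\<close> are matched by adding or removing the block \<open>B\<close>. Subtracting the boundary
      of \<open>w\<close> kills the coefficients of the cells without \<open>B\<close>, and then the cycle condition kills those of the
      cells with \<open>B\<close>.\<close>
    define B where "B = p - r"
    have B: "B \<in> blocks L p" unfolding B_def blocks_def using \<open>r \<in> lower_neighbors L p\<close> by blast
    have "p - B = r" using rI by (auto simp: B_def)
    have extend: "(p, insert B T) \<in> interval_cells L lo hi (Suc m)"
      if "(p, T) \<in> interval_cells L lo hi m" "B \<notin> T" for T
    proof -
      have "p - \<Union>(insert B T) = r \<inter> (p - \<Union>T)" using \<open>p - B = r\<close> by auto
      then show ?thesis using that B rI by (auto simp: interval_cells_def cells_def)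
    qed
    define w where "w = (\<lambda>x. if fst x = p \<and> B \<in> snd x then cell_sign (snd x) B * a (p, snd x - {B}) else 0)"
    have w_supp: "x \<in> interval_cells L lo hi (Suc m) \<and> fst x = p" if "w x \<noteq> 0" for x
    proof -
      obtain T where x: "x = (p, T)" "B \<in> T" "cell_sign T B * a (p, T - {B}) \<noteq> 0"
        using \<open>w x \<noteq> 0\<close> by (cases x) (auto simp: w_def split: if_splits)
      then have "a (p, T - {B}) \<noteq> 0" by auto
      then have "(p, insert B (T - {B})) \<in> interval_cells L lo hi (Suc m)"
        using supp extend by blast
      with x show ?thesis by (simp add: insert_absorb)
    qed
    \<comment> \<open>A face without \<open>B\<close> receives a contribution of \<open>w\<close>
      only from the cell with \<open>B\<close> added, and the sign in \<open>w\<close> cancels the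
      incidence number.\<close>
    have w_diff: "cell_diff L w (p, U) = a (p, U)" if "B \<notin> U" for U
    proof (cases "(p, U) \<in> cells L")
      case True
      have c: "(p, insert B U) \<in> cells L" using True B by (auto simp: cells_def)
      have "cell_diff L w (p, U) = w (p, insert B U) * cell_bd (p, insert B U) (p, U)"
      proof (rule cell_diff_single[OF c], rule ccontr)
        fix x assume "x \<noteq> (p, insert B U)" "w x * cell_bd x (p, U) \<noteq> 0"
        moreover from this have "w x \<noteq> 0" by auto
        then obtain T where "x = (p, T)" "B \<in> T" by (cases x) (auto simp: w_def split: if_splits)
        moreover from calculation have "cell_bd (p, T) (p, U) \<noteq> (0::'k)" by auto
        then obtain C where "C \<in> T" "U = T - {C}" by (rule cell_bd_nonzeroD)
        ultimately show False using \<open>B \<notin> U\<close> by auto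
      qed
      moreover have "cell_bd (p, insert B U) (p, U) = (cell_sign (insert B U) B :: 'k)"
        using cell_bd_top_face[OF c, of B] that by simp
      ultimately show ?thesis using that by (simp add: w_def mult_ac flip: mult.assoc)
    next
      case False
      then have "a (p, U) = 0" using supp by (auto simp: interval_cells_def)
      moreover have "cell_diff L w (p, U) = 0"
      proof (rule ccontr)
        assume "cell_diff L w (p, U) \<noteq> 0"
        then have "(p, U) \<in> interval_cells L lo hi m"
          using cell_diff_interval_cells[of w lo hi m] w_supp by metis
        then show False using False by (simp add: interval_cells_def)
      qed
      ultimately show ?thesis by simp
    qed
    define a' where "a' = (\<lambda>x. a x - cell_diff L w x)"
    have a'_supp: "x \<in> interval_cells L lo hi m \<and> fst x \<in> D" if "a' x \<noteq> 0" for x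
    proof (cases "a x = 0")
      case True
      then have "cell_diff L w x \<noteq> 0" using that by (simp add: a'_def)
      then obtain z where z: "w z \<noteq> 0" "x \<in> interval_cells L lo hi m" "fst x \<subseteq> fst z"
        using cell_diff_interval_cells[of w] w_supp by metis
      then have "fst x \<subseteq> p" using w_supp by blast
      moreover have "fst x \<in> lattice_interval L lo hi"
        using z(2) by (auto simp: interval_cells_def lattice_interval_def cells_def)
      ultimately show ?thesis using down[OF p(1)] z(2) by blast
    qed (use supp in blast)
    have a'_cyc: "if m = 0 then cell_aug L a' = 0 else \<forall>y. cell_diff L a' y = 0"
    proof (cases "m = 0")
      case True
      have "cell_aug L a' = cell_aug L a - cell_aug L (cell_diff L w)"
        by (simp add: a'_def cell_aug_def sum_subtractf)
      then show ?thesis using True cyc by (simp add: cell_aug_diff)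
    next
      case False
      then show ?thesis using cyc by (simp add: a'_def cell_diff_minus cell_diff_diff)
    qed
    have a'_zero: "a' (p, U) = 0" for U
    proof (cases "B \<in> U \<and> (p, U) \<in> interval_cells L lo hi m")
      case True
      then have c: "(p, U) \<in> cells L" and "B \<in> U" "m \<noteq> 0"
        by (auto simp: interval_cells_def card_gt_0_iff)
      \<comment> \<open>No other cell contributes to this facet: maximality of \<open>p\<close>
        excludes larger tops, and \<open>a'\<close> already vanishes on the cells with top
        \<open>p\<close> that omit \<open>B\<close>.\<close>
      have "cell_diff L a' (p, U - {B}) = a' (p, U) * cell_bd (p, U) (p, U - {B})"
      proof (rule cell_diff_single[OF c], rule ccontr)
        fix x assume x: "x \<noteq> (p, U)" "a' x * cell_bd x (p, U - {B}) \<noteq> 0"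
        obtain q T where qT: "x = (q, T)" by (cases x)
        have a'x: "a' (q, T) \<noteq> 0" and bd: "cell_bd (q, T) (p, U - {B}) \<noteq> (0::'k)"
          using x(2) qT by auto
        obtain C where C: "C \<in> T" "U - {B} = T - {C}" "p = q \<or> p = q - C"
          using bd by (rule cell_bd_nonzeroD)
        have "q = p" using p(2)[of q] a'_supp[OF a'x] C(3) by auto
        have "B \<in> T" using w_diff[of T] a'x \<open>q = p\<close> by (auto simp: a'_def)
        then have "T = U" using C \<open>B \<in> U\<close> by blast
        then show False using x qT \<open>q = p\<close> by simp
      qed
      moreover have "cell_bd (p, U) (p, U - {B}) = (cell_sign U B :: 'k)"
        by (rule cell_bd_top_face[OF c \<open>B \<in> U\<close>])
      ultimately have "a' (p, U) * cell_sign U B = 0" using a'_cyc \<open>m \<noteq> 0\<close> by simp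
      then have "a' (p, U) * (cell_sign U B * cell_sign U B) = 0"
        by (simp flip: mult.assoc del: cell_sign_square)
      then show ?thesis by simp
    next
      case False
      then show ?thesis using w_diff[of U] a'_supp[of "(p, U)"] by (auto simp: a'_def)
    qed
    have "card (D - {p}) < card D" using p(1) by (meson card_Diff1_less finite)
    \<comment> \<open>Removing \<open>p\<close> keeps the set down-closed because \<open>p\<close>
      is maximal in it.\<close>
    moreover have "q' \<in> D - {p}" if "q \<in> D - {p}" "q' \<in> lattice_interval L lo hi" "q' \<subseteq> q" for q q'
      using down[of q q'] that p(2)[of q] by auto
    moreover have "x \<in> interval_cells L lo hi m \<and> fst x \<in> D - {p}" if "a' x \<noteq> 0" for x
      using a'_supp[OF that] a'_zero[of "snd x"] that by auto
    ultimately obtain b where b: "\<And>x. b x \<noteq> 0 \<Longrightarrow> x \<in> interval_cells L lo hi (Suc m)"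
      "\<And>y. cell_diff L b y = a' y"
      using less.hyps[of "D - {p}" a'] D a'_cyc by blast
    show ?thesis
    proof (intro exI[of _ "\<lambda>x. b x + w x"] conjI allI impI)
      show "x \<in> interval_cells L lo hi (Suc m)" if "b x + w x \<noteq> 0" for x
        using b(1)[of x] w_supp[of x] that by (cases "b x = 0") auto
      show "cell_diff L (\<lambda>x. b x + w x) y = a y" for y
        by (simp add: cell_diff_add b(2) a'_def)
    qed
  qed
qed

lemma cell_complex_exact:
  fixes a :: "'n set \<times> 'n set set \<Rightarrow> 'k::comm_ring_1"
  assumes "\<And>x. a x \<noteq> 0 \<Longrightarrow> x \<in> interval_cells L lo hi m"
    and "if m = 0 then cell_aug L a = 0 else \<forall>y. cell_diff L a y = 0"
  obtains b where "\<And>x. b x \<noteq> 0 \<Longrightarrow> x \<in> interval_cells L lo hi (Suc m)" "\<And>y. cell_diff L b y = a y"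
proof -
  have "fst x \<in> lattice_interval L lo hi" if "a x \<noteq> 0" for x
    using assms(1)[OF that] by (auto simp: interval_cells_def lattice_interval_def cells_def)
  then have "\<exists>b. (\<forall>x. b x \<noteq> 0 \<longrightarrow> x \<in> interval_cells L lo hi (Suc m)) \<and> (\<forall>y. cell_diff L b y = a y)"
    using assms by (intro cell_complex_exact_aux[of "lattice_interval L lo hi"]) auto
  with that show thesis by blast
qed

end


section \<open>Comparison of filtered complexes\<close>

text \<open>Coordinates of the degree \<open>c\<close> part of a multigraded free module: a
  generator of degree \<open>d j\<close> contributes, multiplied by a single monomial, exactly when
  \<open>d j \<le> c\<close>.\<close>

definition filtered_chains :: "nat \<Rightarrow> (nat \<Rightarrow> 'd::order) \<Rightarrow> 'd \<Rightarrow> (nat \<Rightarrow> 'k::comm_ring_1) set" where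
  "filtered_chains n d c = {a. \<forall>j. a j \<noteq> 0 \<longrightarrow> j < n \<and> d j \<le> c}"

definition degree_chains :: "nat \<Rightarrow> (nat \<Rightarrow> 'd::order) \<Rightarrow> 'd \<Rightarrow> (nat \<Rightarrow> 'k::comm_ring_1) set" where
  "degree_chains n d b = {a. \<forall>j. a j \<noteq> 0 \<longrightarrow> j < n \<and> d j = b}"

text \<open>Passes from the filtration to its graded piece of degree \<open>b\<close>; this will
  take the role of tensoring with K.\<close>

definition degree_part :: "(nat \<Rightarrow> 'd) \<Rightarrow> 'd \<Rightarrow> (nat \<Rightarrow> 'k::comm_ring_1) \<Rightarrow> nat \<Rightarrow> 'k" where
  "degree_part d b a = (\<lambda>j. if d j = b then a j else 0)"

definition filtered_linear :: "nat \<Rightarrow> (nat \<Rightarrow> 'd::order) \<Rightarrow> nat \<Rightarrow> (nat \<Rightarrow> 'd) \<Rightarrow>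
    ((nat \<Rightarrow> 'k::comm_ring_1) \<Rightarrow> (nat \<Rightarrow> 'k)) \<Rightarrow> bool" where
  "filtered_linear n d n' d' f \<longleftrightarrow>
    (\<forall>a b. f (a + b) = f a + f b) \<and> (\<forall>r a. f (\<lambda>j. r * a j) = (\<lambda>j. r * f a j)) \<and>
    (\<forall>c. \<forall>a\<in>filtered_chains n d c. f a \<in> filtered_chains n' d' c)"

lemma filtered_linearD:
  assumes "filtered_linear n d n' d' f"
  shows "f (a + b) = f a + f b" "f (\<lambda>j. r * a j) = (\<lambda>j. r * f a j)"
    "a \<in> filtered_chains n d c \<Longrightarrow> f a \<in> filtered_chains n' d' c"
    "f 0 = 0" "f (a - b) = f a - f b"
proof -
  show add: "f (a + b) = f a + f b" for a b using assms by (simp add: filtered_linear_def)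
  show "f (\<lambda>j. r * a j) = (\<lambda>j. r * f a j)" using assms by (simp add: filtered_linear_def)
  show "a \<in> filtered_chains n d c \<Longrightarrow> f a \<in> filtered_chains n' d' c"
    using assms by (simp add: filtered_linear_def)
  show "f 0 = 0" using add[of 0 0] by simp
  show "f (a - b) = f a - f b" using add[of "a - b" b] by (simp add: algebra_simps)
qed

section \<open>Linear maps between filtered free modules\<close>

lemma filtered_chains_zero [simp]: "0 \<in> filtered_chains n d c"
  by (simp add: filtered_chains_def)

lemma filtered_chains_add:
  "a \<in> filtered_chains n d c \<Longrightarrow> b \<in> filtered_chains n d c \<Longrightarrow> a + b \<in> filtered_chains n d c"
  by (auto simp: filtered_chains_def) (metis add.right_neutral)+

lemma filtered_chains_diff:
  "a \<in> filtered_chains n d c \<Longrightarrow> b \<in> filtered_chains n d c \<Longrightarrow> a - b \<in> filtered_chains n d c"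
  by (auto simp: filtered_chains_def) (metis diff_zero)+

lemma filtered_linear_id: "filtered_linear n d n d (\<lambda>a. a)"
  by (simp add: filtered_linear_def)

lemma filtered_linear_zero: "filtered_linear n d n' d' (\<lambda>a. 0)"
  by (auto simp: filtered_linear_def zero_fun_def filtered_chains_def)

lemma filtered_linear_comp:
  assumes "filtered_linear n d n' d' f" "filtered_linear n' d' n'' d'' g"
  shows "filtered_linear n d n'' d'' (\<lambda>a. g (f a))"
  unfolding filtered_linear_def using filtered_linearD[OF assms(1)] filtered_linearD[OF assms(2)] by simp

lemma filtered_linear_diff:
  assumes "filtered_linear n d n' d' f" "filtered_linear n d n' d' g"
  shows "filtered_linear n d n' d' (\<lambda>a. f a - g a)"
  unfolding filtered_linear_def
proof (intro conjI allI ballI)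
  show "f (a + b) - g (a + b) = f a - g a + (f b - g b)" for a b
    using filtered_linearD(1)[OF assms(1)] filtered_linearD(1)[OF assms(2)] by simp
  show "f (\<lambda>j. r * a j) - g (\<lambda>j. r * a j) = (\<lambda>j. r * (f a - g a) j)" for r a
    by (simp add: filtered_linearD(2)[OF assms(1)] filtered_linearD(2)[OF assms(2)] fun_diff_def right_diff_distrib)
  show "f a - g a \<in> filtered_chains n' d' c" if "a \<in> filtered_chains n d c" for a c
    using that filtered_linearD(3)[OF assms(1)] filtered_linearD(3)[OF assms(2)]
    by (intro filtered_chains_diff)
qed

lemma sum_fun_apply: "(\<Sum>j\<in>A. g j) i = (\<Sum>j\<in>A. g j i :: 'b::comm_monoid_add)"
  by (induction A rule: infinite_finite_induct) simp_all

lemma filtered_chains_expand: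
  assumes "a \<in> filtered_chains n d c"
  shows "a = (\<Sum>j<n. (\<lambda>i. a j * unit_chain j i))"
proof
  fix i
  have "(\<Sum>j<n. a j * unit_chain j i) = (\<Sum>j<n. if i = j then a i else 0)"
    by (rule sum.cong) (auto simp: unit_chain_def)
  then show "a i = (\<Sum>j<n. (\<lambda>i. a j * unit_chain j i)) i"
    using assms by (auto simp: sum_fun_apply filtered_chains_def)
qed

lemma filtered_linear_expand:
  assumes "filtered_linear n d n' d' f" "a \<in> filtered_chains n d c"
  shows "f a k = (\<Sum>j<n. a j * f (unit_chain j) k)"
proof -
  have sum: "f (\<Sum>j\<in>A. g j) = (\<Sum>j\<in>A. f (g j))" for A and g :: "nat \<Rightarrow> nat \<Rightarrow> 'b"
  proof (induction A rule: infinite_finite_induct)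
    case (insert j A)
    show ?case
      unfolding sum.insert[OF insert.hyps] filtered_linearD(1)[OF assms(1)] insert.IH ..
  next
    case empty
    show ?case unfolding sum.empty by (rule filtered_linearD(4)[OF assms(1)])
  next
    case (infinite A)
    show ?case unfolding sum.infinite[OF infinite] by (rule filtered_linearD(4)[OF assms(1)])
  qed
  have "f a = f (\<Sum>j<n. (\<lambda>i. a j * unit_chain j i))"
    using filtered_chains_expand[OF assms(2)] by simp
  also have "\<dots> = (\<Sum>j<n. (\<lambda>i. a j * f (unit_chain j) i))"
    by (simp add: sum filtered_linearD(2)[OF assms(1)])
  finally show ?thesis by (simp add: sum_fun_apply)
qed

lemma unit_chain_filtered: "j < n \<Longrightarrow> d j \<le> c \<Longrightarrow> unit_chain j \<in> filtered_chains n d c"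
  by (simp add: filtered_chains_def unit_chain_def)

lemma filtered_linear_eqI:
  assumes "filtered_linear n d n' d' f" "filtered_linear n d n'' d'' g"
    and "\<And>j. j < n \<Longrightarrow> f (unit_chain j) = g (unit_chain j)" and "a \<in> filtered_chains n d c"
  shows "f a = g a"
proof
  fix k
  show "f a k = g a k"
    unfolding filtered_linear_expand[OF assms(1,4)] filtered_linear_expand[OF assms(2,4)]
    by (rule sum.cong) (simp_all add: assms(3))
qed

lemma filtered_linear_apply_mat:
  assumes "\<And>k j. k < r \<Longrightarrow> j < s \<Longrightarrow> A k j \<noteq> 0 \<Longrightarrow> d' k \<le> d j"
  shows "filtered_linear s d r d' (apply_mat r s A)"
  unfolding filtered_linear_def
proof (intro conjI allI ballI)
  show "apply_mat r s A (a + b) = apply_mat r s A a + apply_mat r s A b" for a b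
    by (auto simp: apply_mat_def algebra_simps sum.distrib)
  show "apply_mat r s A (\<lambda>j. x * a j) = (\<lambda>k. x * apply_mat r s A a k)" for x a
    by (auto simp: apply_mat_def algebra_simps sum_distrib_left)
  show "apply_mat r s A a \<in> filtered_chains r d' c" if a: "a \<in> filtered_chains s d c" for a c
    unfolding filtered_chains_def
  proof (intro CollectI allI impI)
    fix k assume "apply_mat r s A a k \<noteq> 0"
    then have k: "k < r" and "(\<Sum>j<s. A k j * a j) \<noteq> 0" by (auto simp: apply_mat_def split: if_splits)
    then obtain j where j: "j < s" "A k j * a j \<noteq> 0" by (auto elim!: sum.not_neutral_contains_not_neutral)
    then have "A k j \<noteq> 0" "a j \<noteq> 0" by auto
    then show "k < r \<and> d' k \<le> c"
      using assms[OF k j(1)] a k j(1) by (auto simp: filtered_chains_def intro: order_trans)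
  qed
qed

text \<open>Freeness: the images of the basis vectors may be prescribed, each within the filtration
  step of its own degree.\<close>

lemma filtered_linear_extend:
  assumes "\<And>j. j < n \<Longrightarrow> y j \<in> filtered_chains n' d' (d j)"
  obtains f :: "(nat \<Rightarrow> 'k::comm_ring_1) \<Rightarrow> _"
    where "filtered_linear n d n' d' f" "\<And>j. j < n \<Longrightarrow> f (unit_chain j) = y j"
proof
  let ?f = "apply_mat n' n (\<lambda>k j. y j k)"
  show "filtered_linear n d n' d' ?f"
    by (rule filtered_linear_apply_mat) (use assms in \<open>auto simp: filtered_chains_def\<close>)
  show "?f (unit_chain j) = y j" if j: "j < n" for j
  proof
    fix k
    have "(\<Sum>i<n. y i k * unit_chain j i) = (\<Sum>i<n. if i = j then y j k else 0)"
      by (rule sum.cong) (auto simp: unit_chain_def)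
    then show "?f (unit_chain j) k = y j k"
      using j assms[OF j] by (auto simp: apply_mat_def filtered_chains_def)
  qed
qed

text \<open>Projectivity of filtered free modules: each basis vector is lifted inside the filtration
  step of its own degree, the smallest one that contains it, and linear extension then respects all
  steps.\<close>

lemma filtered_lift:
  fixes h :: "(nat \<Rightarrow> 'k::comm_ring_1) \<Rightarrow> _"
  assumes D: "filtered_linear n' d' n'' d'' D" and h: "filtered_linear n d n'' d'' h"
    and im: "\<And>c a. a \<in> filtered_chains n d c \<Longrightarrow> h a \<in> D ` filtered_chains n' d' c"
  obtains f where "filtered_linear n d n' d' f" "\<And>c a. a \<in> filtered_chains n d c \<Longrightarrow> D (f a) = h a"
proof -
  have "\<exists>y\<in>filtered_chains n' d' (d j). D y = h (unit_chain j)" if "j < n" for j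
    using im[OF unit_chain_filtered[OF that order_refl, of d]] by force
  then obtain y where y: "\<And>j. j < n \<Longrightarrow> y j \<in> filtered_chains n' d' (d j)"
    "\<And>j. j < n \<Longrightarrow> D (y j) = h (unit_chain j)"
    by metis
  obtain f :: "(nat \<Rightarrow> 'k) \<Rightarrow> _" where f: "filtered_linear n d n' d' f" "\<And>j. j < n \<Longrightarrow> f (unit_chain j) = y j"
    by (rule filtered_linear_extend[of n y n' d' d]) (rule y(1), auto)
  have "D (f a) = h a" if "a \<in> filtered_chains n d c" for a c
    by (rule filtered_linear_eqI[OF filtered_linear_comp[OF f(1) D] h _ that]) (simp add: f(2) y(2))
  with f(1) show thesis by (rule that)
qed

text \<open>A generator of degree strictly below \<open>b\<close> is sent to chains of degree at
  most its own, which have no component of degree \<open>b\<close>. So a filtered map induces maps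
  on the graded pieces.\<close>

lemma degree_part_filtered:
  assumes f: "filtered_linear n d n' d' f" and a: "a \<in> filtered_chains n d b"
  shows "degree_part d' b (f (degree_part d b a)) = degree_part d' b (f a)"
proof
  fix k
  have pa: "degree_part d b a \<in> filtered_chains n d b"
    using a by (auto simp: degree_part_def filtered_chains_def)
  have "degree_part d b a j * f (unit_chain j) k = a j * f (unit_chain j) k" if "j < n" "d' k = b" for j
  proof (cases "d j = b \<or> a j = 0")
    case False
    then have "d j \<le> b" "d j \<noteq> b" using a by (auto simp: filtered_chains_def)
    moreover have "f (unit_chain j) \<in> filtered_chains n' d' (d j)"
      by (rule filtered_linearD(3)[OF f unit_chain_filtered[OF that(1) order_refl]])
    ultimately have "f (unit_chain j) k = 0"
      using that(2) by (auto simp: filtered_chains_def dest: order.antisym)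
    then show ?thesis by simp
  qed (auto simp: degree_part_def)
  then have "(\<Sum>j<n. degree_part d b a j * f (unit_chain j) k) = (\<Sum>j<n. a j * f (unit_chain j) k)"
    if "d' k = b"
    using that by (intro sum.cong) auto
  then show "degree_part d' b (f (degree_part d b a)) k = degree_part d' b (f a) k"
    unfolding degree_part_def[of d'] filtered_linear_expand[OF f a] filtered_linear_expand[OF f pa]
    by auto
qed

lemma degree_part_in: "a \<in> filtered_chains n d c \<Longrightarrow> degree_part d b a \<in> degree_chains n d b"
  by (auto simp: degree_part_def filtered_chains_def degree_chains_def)

lemma degree_chains_filtered: "a \<in> degree_chains n d b \<Longrightarrow> a \<in> filtered_chains n d b"
  by (auto simp: filtered_chains_def degree_chains_def)

lemma degree_part_id: "a \<in> degree_chains n d b \<Longrightarrow> degree_part d b a = a"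
  by (rule ext) (auto simp: degree_part_def degree_chains_def)

lemma degree_part_add: "degree_part d b (x + y) = degree_part d b x + degree_part d b y"
  by (auto simp: degree_part_def)

lemma degree_part_zero [simp]: "degree_part d b 0 = 0"
  by (auto simp: degree_part_def)

text \<open>In the application index 0 holds the ring that receives the augmentation, so exactness
  is required from index 1 on. One family of maps \<open>D\<close> serves all filtration steps
  \<open>c\<close> at once.\<close>

locale filtered_complex =
  fixes n :: "nat \<Rightarrow> nat" and d :: "nat \<Rightarrow> nat \<Rightarrow> 'd::order"
    and D :: "nat \<Rightarrow> (nat \<Rightarrow> 'k::comm_ring_1) \<Rightarrow> (nat \<Rightarrow> 'k)"
  assumes D_linear: "filtered_linear (n (Suc m)) (d (Suc m)) (n m) (d m) (D m)"
    and exact: "{a \<in> filtered_chains (n (Suc m)) (d (Suc m)) c. D m a = 0} =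
      D (Suc m) ` filtered_chains (n (Suc (Suc m))) (d (Suc (Suc m))) c"
begin

abbreviation "C m c \<equiv> filtered_chains (n m) (d m) c"

definition "graded_diff m b a = degree_part (d m) b (D m a)"

text \<open>Homological degree \<open>m\<close> sits at index \<open>Suc m\<close>. For
  \<open>m = 0\<close> every chain is a cycle, because Tor is computed without the
  augmentation.\<close>

definition "graded_cycles m b =
  {a \<in> degree_chains (n (Suc m)) (d (Suc m)) b. m = 0 \<or> graded_diff m b a = 0}"

definition "graded_boundaries m b =
  graded_diff (Suc m) b ` degree_chains (n (Suc (Suc m))) (d (Suc (Suc m))) b"

lemma D_C: "a \<in> C (Suc m) c \<Longrightarrow> D m a \<in> C m c"
  using filtered_linearD(3)[OF D_linear] .

lemma D_D: "a \<in> C (Suc (Suc m)) c \<Longrightarrow> D m (D (Suc m) a) = 0"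
  using exact[of m c] by auto

lemma exactD: "a \<in> C (Suc m) c \<Longrightarrow> D m a = 0 \<Longrightarrow> a \<in> D (Suc m) ` C (Suc (Suc m)) c"
  using exact[of m c] by auto

lemma graded_boundaries_subset: "graded_boundaries m b \<subseteq> graded_cycles m b"
proof
  fix x assume "x \<in> graded_boundaries m b"
  then obtain a where a: "a \<in> degree_chains (n (Suc (Suc m))) (d (Suc (Suc m))) b" "x = graded_diff (Suc m) b a"
    by (auto simp: graded_boundaries_def)
  have aC: "a \<in> C (Suc (Suc m)) b" using a(1) by (rule degree_chains_filtered)
  have "graded_diff m b x = degree_part (d m) b (D m (D (Suc m) a))"
    unfolding graded_diff_def a(2) by (rule degree_part_filtered[OF D_linear D_C[OF aC]])
  then show "x \<in> graded_cycles m b"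
    using D_D[OF aC] degree_part_in[OF D_C[OF aC]] a(2)
    by (simp add: graded_cycles_def) (simp add: graded_diff_def)
qed

text \<open>The homotopy is built degree by degree: since \<open>\<phi>\<close> commutes with
  \<open>D\<close>, the difference of \<open>\<phi>\<close> and the previous homotopy after
  \<open>D\<close> takes values in cycles, which are boundaries by exactness, and can be
  lifted.\<close>

lemma null_homotopy:
  assumes \<phi>: "\<And>m. filtered_linear (n m) (d m) (n m) (d m) (\<phi> m)"
    and comm: "\<And>m c a. a \<in> C (Suc m) c \<Longrightarrow> D m (\<phi> (Suc m) a) = \<phi> m (D m a)"
    and zero: "\<And>a. \<phi> 0 a = 0"
  obtains h where "\<And>m. filtered_linear (n m) (d m) (n (Suc m)) (d (Suc m)) (h m)" "h 0 = (\<lambda>a. 0)"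
    "\<And>m c a. a \<in> C (Suc m) c \<Longrightarrow> D (Suc m) (h (Suc m) a) = \<phi> (Suc m) a - h m (D m a)"
proof -
  \<comment> \<open>Besides the current map, the invariant records that the next lifting problem is
    solvable.\<close>
  let ?P = "\<lambda>m h. filtered_linear (n m) (d m) (n (Suc m)) (d (Suc m)) h \<and> (m = 0 \<longrightarrow> h = (\<lambda>a. 0)) \<and>
      (\<forall>c. \<forall>a\<in>C (Suc m) c. \<phi> (Suc m) a - h (D m a) \<in> D (Suc m) ` C (Suc (Suc m)) c)"
  let ?Q = "\<lambda>m h h'. \<forall>c. \<forall>a\<in>C (Suc m) c. D (Suc m) (h' a) = \<phi> (Suc m) a - h (D m a)"
  have "\<exists>h. \<forall>m. ?P m (h m) \<and> ?Q m (h m) (h (Suc m))"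
  proof (rule dependent_nat_choice)
    have "\<phi> (Suc 0) a \<in> D (Suc 0) ` C (Suc (Suc 0)) c" if "a \<in> C (Suc 0) c" for a c
      using that by (intro exactD filtered_linearD(3)[OF \<phi>]) (simp_all add: comm[OF that] zero)
    then show "\<exists>h. ?P 0 h"
      by (intro exI[of _ "\<lambda>a. 0"]) (simp add: filtered_linear_zero)
  next
    fix h m assume h: "?P m h"
    have hD: "filtered_linear (n (Suc m)) (d (Suc m)) (n (Suc m)) (d (Suc m)) (\<lambda>a. h (D m a))"
      using filtered_linear_comp[OF D_linear] h by blast
    obtain h' where h': "filtered_linear (n (Suc m)) (d (Suc m)) (n (Suc (Suc m))) (d (Suc (Suc m))) h'"
      "\<And>c a. a \<in> C (Suc m) c \<Longrightarrow> D (Suc m) (h' a) = \<phi> (Suc m) a - h (D m a)"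
      using filtered_lift[OF D_linear filtered_linear_diff[OF \<phi> hD]] h by blast
    have "\<phi> (Suc (Suc m)) a - h' (D (Suc m) a) \<in> D (Suc (Suc m)) ` C (Suc (Suc (Suc m))) c"
      if a: "a \<in> C (Suc (Suc m)) c" for a c
    proof (rule exactD)
      show "\<phi> (Suc (Suc m)) a - h' (D (Suc m) a) \<in> C (Suc (Suc m)) c"
        using a D_C filtered_linearD(3)[OF \<phi>] filtered_linearD(3)[OF h'(1)]
        by (intro filtered_chains_diff) auto
      have "h 0 = 0" using h filtered_linearD(4) by blast
      then show "D (Suc m) (\<phi> (Suc (Suc m)) a - h' (D (Suc m) a)) = 0"
        by (simp add: filtered_linearD(5)[OF D_linear] comm[OF a] h'(2)[OF D_C[OF a]] D_D[OF a])
    qed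
    with h' show "\<exists>h'. ?P (Suc m) h' \<and> ?Q m h h'" by blast
  qed
  then obtain h where "\<And>m. ?P m (h m) \<and> ?Q m (h m) (h (Suc m))" by blast
  then show thesis by (intro that) blast+
qed

end

text \<open>The comparison theorem, starting from the identity at index 0. The inclusion of images
  makes the first lift possible; exactness of the target makes the later ones possible.\<close>

lemma comparison_map:
  assumes "filtered_complex n d D" "filtered_complex n' d' D'"
    and "n 0 = n' 0" "d 0 = d' 0"
    and im: "\<And>c. D 0 ` filtered_chains (n 1) (d 1) c \<subseteq> D' 0 ` filtered_chains (n' 1) (d' 1) c"
  obtains f where "\<And>m. filtered_linear (n m) (d m) (n' m) (d' m) (f m)" "f 0 = (\<lambda>a. a)"
    "\<And>m c a. a \<in> filtered_chains (n (Suc m)) (d (Suc m)) c \<Longrightarrow> D' m (f (Suc m) a) = f m (D m a)"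
proof -
  interpret A: filtered_complex n d D by fact
  interpret B: filtered_complex n' d' D' by fact
  let ?P = "\<lambda>m f. filtered_linear (n m) (d m) (n' m) (d' m) f \<and> (m = 0 \<longrightarrow> f = (\<lambda>a. a)) \<and>
      (\<forall>c. \<forall>a\<in>A.C (Suc m) c. f (D m a) \<in> D' m ` B.C (Suc m) c)"
  let ?Q = "\<lambda>m f f'. \<forall>c. \<forall>a\<in>A.C (Suc m) c. D' m (f' a) = f (D m a)"
  have "\<exists>f. \<forall>m. ?P m (f m) \<and> ?Q m (f m) (f (Suc m))"
  proof (rule dependent_nat_choice)
    show "\<exists>f. ?P 0 f"
      using im assms(3,4) by (intro exI[of _ "\<lambda>a. a"]) (auto simp: filtered_linear_id)
  next
    fix f m assume f: "?P m f"
    have fD: "filtered_linear (n (Suc m)) (d (Suc m)) (n' m) (d' m) (\<lambda>a. f (D m a))"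
      using filtered_linear_comp[OF A.D_linear] f by blast
    obtain f' where f': "filtered_linear (n (Suc m)) (d (Suc m)) (n' (Suc m)) (d' (Suc m)) f'"
      "\<And>c a. a \<in> A.C (Suc m) c \<Longrightarrow> D' m (f' a) = f (D m a)"
      using filtered_lift[OF B.D_linear fD] f by blast
    have "f' (D (Suc m) a) \<in> D' (Suc m) ` B.C (Suc (Suc m)) c" if a: "a \<in> A.C (Suc (Suc m)) c" for a c
    proof (rule B.exactD)
      show "f' (D (Suc m) a) \<in> B.C (Suc m) c"
        using filtered_linearD(3)[OF f'(1)] A.D_C[OF a] .
      have "f 0 = 0" using f filtered_linearD(4) by blast
      then show "D' m (f' (D (Suc m) a)) = 0" by (simp add: f'(2)[OF A.D_C[OF a]] A.D_D[OF a])
    qed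
    with f' show "\<exists>f'. ?P (Suc m) f' \<and> ?Q m f f'" by blast
  qed
  then obtain f where "\<And>m. ?P m (f m) \<and> ?Q m (f m) (f (Suc m))" by blast
  then show thesis by (intro that) blast+
qed

text \<open>The comparison maps \<open>f\<close> and \<open>g\<close> and a homotopy
  \<open>h\<close> between the identity and their composite pass to the graded pieces. If
  \<open>w\<close> bounds the image under \<open>f\<close> of a cycle \<open>a\<close>, then the
  degree \<open>b\<close> part of \<open>g w + h a\<close> bounds \<open>a\<close>.\<close>

lemma graded_exactness_transfer:
  assumes A: "filtered_complex n d D" and B: "filtered_complex n' d' D'"
    and "n 0 = n' 0" "d 0 = d' 0"
    and im: "\<And>c. D 0 ` filtered_chains (n 1) (d 1) c = D' 0 ` filtered_chains (n' 1) (d' 1) c"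
    and exact: "filtered_complex.graded_cycles n' d' D' m b = filtered_complex.graded_boundaries n' d' D' m b"
  shows "filtered_complex.graded_cycles n d D m b = filtered_complex.graded_boundaries n d D m b"
proof -
  interpret A: filtered_complex n d D by fact
  interpret B: filtered_complex n' d' D' by fact
  obtain f where f: "\<And>m. filtered_linear (n m) (d m) (n' m) (d' m) (f m)" "f 0 = (\<lambda>a. a)"
    "\<And>m c a. a \<in> A.C (Suc m) c \<Longrightarrow> D' m (f (Suc m) a) = f m (D m a)"
    using comparison_map[OF A B assms(3,4)] im by blast
  obtain g where g: "\<And>m. filtered_linear (n' m) (d' m) (n m) (d m) (g m)" "g 0 = (\<lambda>a. a)"
    "\<And>m c a. a \<in> B.C (Suc m) c \<Longrightarrow> D m (g (Suc m) a) = g m (D' m a)"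
    using comparison_map[OF B A assms(3,4)[symmetric]] im by blast
  obtain h where h: "\<And>m. filtered_linear (n m) (d m) (n (Suc m)) (d (Suc m)) (h m)" "h 0 = (\<lambda>a. 0)"
    "\<And>m c a. a \<in> A.C (Suc m) c \<Longrightarrow> D (Suc m) (h (Suc m) a) = a - g (Suc m) (f (Suc m) a) - h m (D m a)"
  proof -
    have "filtered_linear (n m) (d m) (n m) (d m) (\<lambda>a. a - g m (f m a))" for m
      by (rule filtered_linear_diff[OF filtered_linear_id filtered_linear_comp[OF f(1) g(1)]])
    moreover have "D m (a - g (Suc m) (f (Suc m) a)) = D m a - g m (f m (D m a))" if "a \<in> A.C (Suc m) c" for m c a
      by (simp add: filtered_linearD(5)[OF A.D_linear] g(3)[OF filtered_linearD(3)[OF f(1) that]] f(3)[OF that])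
    moreover have "a - g 0 (f 0 a) = 0" for a by (simp add: f(2) g(2))
    ultimately show thesis
      using A.null_homotopy[where \<phi> = "\<lambda>m a. a - g m (f m a)"] that by blast
  qed
  have "A.graded_cycles m b \<subseteq> A.graded_boundaries m b"
  proof
    fix a assume "a \<in> A.graded_cycles m b"
    then have a: "a \<in> degree_chains (n (Suc m)) (d (Suc m)) b" "m = 0 \<or> A.graded_diff m b a = 0"
      by (auto simp: A.graded_cycles_def)
    have aC: "a \<in> A.C (Suc m) b" using a(1) by (rule degree_chains_filtered)
    have faC: "f (Suc m) a \<in> B.C (Suc m) b" by (rule filtered_linearD(3)[OF f(1) aC])
    let ?pA = "\<lambda>m. degree_part (d m) b" and ?pB = "\<lambda>m. degree_part (d' m) b"
    have "?pB m (D' m (?pB (Suc m) (f (Suc m) a))) = ?pB m (f m (?pA m (D m a)))"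
      by (simp add: degree_part_filtered[OF B.D_linear faC] f(3)[OF aC]
        degree_part_filtered[OF f(1) A.D_C[OF aC]])
    then have "?pB (Suc m) (f (Suc m) a) \<in> B.graded_cycles m b"
      using a(2) degree_part_in[OF faC] filtered_linearD(4)[OF f(1)]
      by (auto simp: B.graded_cycles_def B.graded_diff_def A.graded_diff_def)
    then obtain w where w: "w \<in> degree_chains (n' (Suc (Suc m))) (d' (Suc (Suc m))) b"
      "?pB (Suc m) (f (Suc m) a) = ?pB (Suc m) (D' (Suc m) w)"
      unfolding exact by (auto simp: B.graded_boundaries_def B.graded_diff_def)
    have wC: "w \<in> B.C (Suc (Suc m)) b" using w(1) by (rule degree_chains_filtered)
    have gw: "g (Suc (Suc m)) w \<in> A.C (Suc (Suc m)) b" by (rule filtered_linearD(3)[OF g(1) wC])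
    have ha: "h (Suc m) a \<in> A.C (Suc (Suc m)) b" by (rule filtered_linearD(3)[OF h(1) aC])
    have 1: "?pA (Suc m) (g (Suc m) (f (Suc m) a)) = ?pA (Suc m) (D (Suc m) (g (Suc (Suc m)) w))"
      using degree_part_filtered[OF g(1) faC] degree_part_filtered[OF g(1) B.D_C[OF wC]] w(2) g(3)[OF wC]
      by simp
    \<comment> \<open>For \<open>m = 0\<close> the homotopy is zero; otherwise \<open>D m a\<close>
      has no part of degree \<open>b\<close>, and the filtered map \<open>h\<close> cannot create
      one.\<close>
    have 2: "?pA (Suc m) (h m (D m a)) = 0"
    proof (cases m)
      case 0
      then show ?thesis by (simp add: h(2))
    next
      case (Suc l)
      then have "?pA m (D m a) = 0" using a(2) by (simp add: A.graded_diff_def)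
      then show ?thesis
        using degree_part_filtered[OF h(1) A.D_C[OF aC]] filtered_linearD(4)[OF h(1)] by simp
    qed
    let ?v = "g (Suc (Suc m)) w + h (Suc m) a"
    have v: "?v \<in> A.C (Suc (Suc m)) b" using gw ha by (rule filtered_chains_add)
    have "a = D (Suc m) (h (Suc m) a) + g (Suc m) (f (Suc m) a) + h m (D m a)"
      by (simp add: h(3)[OF aC])
    then have "?pA (Suc m) a = ?pA (Suc m) (D (Suc m) (h (Suc m) a) + g (Suc m) (f (Suc m) a) + h m (D m a))"
      by simp
    also have "\<dots> = ?pA (Suc m) (D (Suc m) (h (Suc m) a)) + ?pA (Suc m) (D (Suc m) (g (Suc (Suc m)) w))"
      unfolding degree_part_add 1 2 by simp
    also have "\<dots> = ?pA (Suc m) (D (Suc m) ?v)"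
      by (simp add: filtered_linearD(1)[OF A.D_linear] degree_part_add add.commute)
    also have "\<dots> = ?pA (Suc m) (D (Suc m) (?pA (Suc (Suc m)) ?v))"
      by (rule degree_part_filtered[OF A.D_linear v, symmetric])
    finally have "a = A.graded_diff (Suc m) b (?pA (Suc (Suc m)) ?v)"
      by (simp add: degree_part_id[OF a(1)] A.graded_diff_def)
    then show "a \<in> A.graded_boundaries m b"
      unfolding A.graded_boundaries_def using degree_part_in[OF v] by blast
  qed
  then show ?thesis using A.graded_boundaries_subset by blast
qed


section \<open>Strands of multigraded resolutions\<close>

definition exponent :: "('v::finite \<Rightarrow> int) \<Rightarrow> ('v \<Rightarrow>\<^sub>0 nat)" where
  "exponent c = Abs_poly_mapping (\<lambda>v. nat (c v))"

text \<open>Degrees are integer vectors while exponents are natural numbers. The value 0 outside the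
  nonnegative orthant lets differences such as \<open>c - d j\<close> be used without asking whether
  \<open>d j \<le> c\<close>.\<close>

definition coef :: "('v::finite, 'k::comm_ring_1) mpoly \<Rightarrow> ('v \<Rightarrow> int) \<Rightarrow> 'k" where
  "coef f c = (if 0 \<le> c then Poly_Mapping.lookup f (exponent c) else 0)"

definition monomial_term :: "('v::finite \<Rightarrow> int) \<Rightarrow> 'k \<Rightarrow> ('v, 'k::comm_ring_1) mpoly" where
  "monomial_term c x = (if 0 \<le> c then Poly_Mapping.single (exponent c) x else 0)"

section \<open>Coefficients indexed by integer multidegrees\<close>

lemma lookup_exponent [simp]: "Poly_Mapping.lookup (exponent c) v = nat (c v)"
  by (simp add: exponent_def)

lemma exponent_int_lookup [simp]: "exponent (\<lambda>v. int (Poly_Mapping.lookup m v)) = m"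
  by (rule poly_mapping_eqI) simp

lemma exponent_eq_iff: "0 \<le> c \<Longrightarrow> 0 \<le> d \<Longrightarrow> exponent c = exponent d \<longleftrightarrow> c = d"
  by (auto simp: poly_mapping_eq_iff le_fun_def fun_eq_iff eq_nat_nat_iff)

lemma exponent_add: "0 \<le> c \<Longrightarrow> 0 \<le> d \<Longrightarrow> exponent (c + d) = exponent c + exponent d"
  by (rule poly_mapping_eqI) (simp add: lookup_add le_fun_def nat_add_distrib)

lemma exponent_zero [simp]: "exponent 0 = 0"
  by (rule poly_mapping_eqI) simp

lemma coef_zero [simp]: "coef 0 c = 0"
  by (simp add: coef_def)

lemma coef_sum: "coef (\<Sum>j\<in>A. f j) c = (\<Sum>j\<in>A. coef (f j) c)"
  by (simp add: coef_def lookup_sum)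

lemma coef_monomial_term: "coef (monomial_term c x) d = (if c = d \<and> 0 \<le> c then x else 0)"
  by (auto simp: coef_def monomial_term_def lookup_single when_def exponent_eq_iff)

lemma mpoly_eqI:
  fixes f g :: "('v::finite, 'k::comm_ring_1) mpoly"
  assumes "\<And>c. coef f c = coef g c"
  shows "f = g"
proof (rule poly_mapping_eqI)
  fix m :: "'v \<Rightarrow>\<^sub>0 nat"
  have "0 \<le> (\<lambda>v. int (Poly_Mapping.lookup m v))" by (simp add: le_fun_def)
  then show "Poly_Mapping.lookup f m = Poly_Mapping.lookup g m"
    using assms[of "\<lambda>v. int (Poly_Mapping.lookup m v)"] by (simp add: coef_def)
qed

lemma finite_coef_support: "finite {c. coef f c \<noteq> 0}"
proof (rule finite_subset)
  show "{c. coef f c \<noteq> 0} \<subseteq> (\<lambda>m v. int (Poly_Mapping.lookup m v)) ` Poly_Mapping.keys f"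
  proof
    fix c assume "c \<in> {c. coef f c \<noteq> 0}"
    then have c: "0 \<le> c" "Poly_Mapping.lookup f (exponent c) \<noteq> 0" by (auto simp: coef_def split: if_splits)
    then show "c \<in> (\<lambda>m v. int (Poly_Mapping.lookup m v)) ` Poly_Mapping.keys f"
      by (intro image_eqI[of _ _ "exponent c"]) (simp_all add: fun_eq_iff le_fun_def in_keys_iff)
  qed
qed simp

lemma homogeneous_monomial_term: "homogeneous (monomial_term c x) c"
  by (auto simp: homogeneous_def monomial_term_def le_fun_def split: if_splits)

text \<open>The fine grading has at most one monomial in each degree, so a homogeneous polynomial is
  a scalar multiple of it.\<close>

lemma homogeneousD:
  assumes "homogeneous f e"
  shows "f = monomial_term e (coef f e)"
proof (rule mpoly_eqI)
  fix c
  show "coef f c = coef (monomial_term e (coef f e)) c"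
  proof (cases "coef f c = 0")
    case False
    then have c: "0 \<le> c" "exponent c \<in> Poly_Mapping.keys f"
      by (auto simp: coef_def in_keys_iff split: if_splits)
    then have "c = e" using assms by (auto simp: homogeneous_def le_fun_def fun_eq_iff)
    then show ?thesis using c by (simp add: coef_monomial_term)
  next
    case True
    then show ?thesis by (auto simp: coef_monomial_term)
  qed
qed

lemma lookup_single_mult:
  "Poly_Mapping.lookup (Poly_Mapping.single m x * f) (m + k) = x * Poly_Mapping.lookup f (k :: 'v \<Rightarrow>\<^sub>0 nat)"
proof -
  have "Poly_Mapping.lookup (Poly_Mapping.single m x * f) (m + k) =
      (\<Sum>l. (x * (\<Sum>q. Poly_Mapping.lookup f q when m + k = l + q)) when l = m)"
    unfolding lookup_mult by (rule Sum_any.cong) (auto simp: lookup_single when_def)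
  also have "\<dots> = x * (\<Sum>q. Poly_Mapping.lookup f q when q = k)"
    by (simp add: eq_commute[of k])
  finally show ?thesis by simp
qed

lemma coef_monomial_term_mult:
  "coef (monomial_term e x * f) c = (if 0 \<le> e then x * coef f (c - e) else 0)"
proof (cases "0 \<le> e")
  case True
  show ?thesis
  proof (cases "0 \<le> c - e")
    case ce: True
    then have "exponent c = exponent e + exponent (c - e)" "0 \<le> c"
      using True exponent_add[OF True ce] add_nonneg_nonneg[OF True ce] by simp_all
    then show ?thesis using True ce by (simp add: coef_def monomial_term_def lookup_single_mult)
  next
    case False
    \<comment> \<open>Every monomial occurring in the product is divisible by the one of degree
      \<open>e\<close>.\<close>
    have "coef (monomial_term e x * f) c = 0"
    proof (rule ccontr)
      assume "coef (monomial_term e x * f) c \<noteq> 0"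
      then have c: "0 \<le> c" "exponent c \<in> Poly_Mapping.keys (Poly_Mapping.single (exponent e) x * f)"
        using True by (auto simp: coef_def monomial_term_def in_keys_iff split: if_splits)
      then obtain k where "exponent c = exponent e + k"
        using keys_mult[of "Poly_Mapping.single (exponent e) x" f] by (fastforce split: if_splits)
      then have "nat (c v) = nat (e v) + Poly_Mapping.lookup k v" for v
        by (metis lookup_add lookup_exponent)
      then have "e v \<le> c v" for v using c(1) True by (smt (verit) le_fun_def zero_fun_apply nat_le_eq_zle le_add1)
      then have "0 \<le> c - e" by (simp add: le_fun_def)
      with False show False by simp
    qed
    then show ?thesis using False by (simp add: coef_def)
  qed
qed (simp add: monomial_term_def)

lemma coef_homogeneous_mult:
  assumes "homogeneous A e"
  shows "coef (A * f) c = coef A e * coef f (c - e)"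
proof -
  have "coef (A * f) c = coef (monomial_term e (coef A e) * f) c"
    by (subst (1) homogeneousD[OF assms]) (rule refl)
  then show ?thesis by (auto simp: coef_monomial_term_mult coef_def[of A])
qed

text \<open>Constants have degree 0. Hence tensoring with K can keep only matrix entries between
  generators of equal degree.\<close>

lemma homogeneous_lookup_zero:
  assumes "homogeneous f e"
  shows "Poly_Mapping.lookup f 0 = (if e = 0 then coef f e else 0)"
proof (cases "Poly_Mapping.lookup f 0 = 0")
  case False
  then have "0 \<in> Poly_Mapping.keys f" by (simp add: in_keys_iff)
  then have "\<forall>v. int (Poly_Mapping.lookup 0 v) = e v" using assms unfolding homogeneous_def by blast
  then have "e = 0" by (simp add: fun_eq_iff)
  then show ?thesis by (simp add: coef_def)
qed (simp add: coef_def)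

lemma coef_nonzero_nonneg: "coef f c \<noteq> 0 \<Longrightarrow> 0 \<le> c"
  by (auto simp: coef_def split: if_splits)

text \<open>Coordinates of the degree \<open>c\<close> part of \<open>f\<close> when the basis
  element number \<open>j\<close> has degree \<open>d j\<close>: its coefficient there is a multiple
  of the monomial of degree \<open>c - d j\<close>.\<close>

definition strand :: "('v::finite \<Rightarrow> int) \<Rightarrow> (nat \<Rightarrow> 'v \<Rightarrow> int) \<Rightarrow>
    (nat \<Rightarrow> ('v, 'k::comm_ring_1) mpoly) \<Rightarrow> nat \<Rightarrow> 'k" where
  "strand c d f = (\<lambda>j. coef (f j) (c - d j))"

definition unstrand :: "('v::finite \<Rightarrow> int) \<Rightarrow> (nat \<Rightarrow> 'v \<Rightarrow> int) \<Rightarrow>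
    (nat \<Rightarrow> 'k) \<Rightarrow> nat \<Rightarrow> ('v, 'k::comm_ring_1) mpoly" where
  "unstrand c d a = (\<lambda>j. monomial_term (c - d j) (a j))"

lemma strand_in: "f \<in> free_module n \<Longrightarrow> strand c d f \<in> filtered_chains n d c"
  unfolding filtered_chains_def
proof (intro CollectI allI impI)
  fix j assume f: "f \<in> free_module n" and "strand c d f j \<noteq> 0"
  then have nz: "coef (f j) (c - d j) \<noteq> 0" by (simp add: strand_def)
  then have "j < n" using f by (force simp: free_module_def not_le[symmetric])
  moreover have "d j \<le> c" using coef_nonzero_nonneg[OF nz] by simp
  ultimately show "j < n \<and> d j \<le> c" ..
qed

lemma unstrand_in:
  assumes "a \<in> filtered_chains n d c"
  shows "unstrand c d a \<in> free_module n"
proof -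
  have "a j = 0" if "n \<le> j" for j
    using assms that by (force simp: filtered_chains_def not_le[symmetric])
  then show ?thesis by (simp add: unstrand_def free_module_def monomial_term_def)
qed

lemma strand_unstrand:
  assumes "a \<in> filtered_chains n d c"
  shows "strand c' d (unstrand c d a) = (if c' = c then a else 0)"
proof
  fix j
  have "a j \<noteq> 0 \<Longrightarrow> 0 \<le> c - d j" using assms by (auto simp: filtered_chains_def le_fun_def)
  then show "strand c' d (unstrand c d a) j = (if c' = c then a else 0) j"
    by (auto simp: strand_def unstrand_def coef_monomial_term)
qed

lemma strand_eqI:
  assumes "\<And>c. strand c d f = strand c d g"
  shows "f = g"
proof (rule ext, rule mpoly_eqI)
  fix j c
  show "coef (f j) c = coef (g j) c"
    using fun_cong[OF assms[of "c + d j"], of j] by (simp add: strand_def)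
qed

lemma strand_zero [simp]: "strand c d 0 = 0"
  by (auto simp: strand_def)

lemma strand_sum: "strand c d (\<lambda>j. \<Sum>i\<in>A. f i j) = (\<lambda>j. \<Sum>i\<in>A. strand c d (f i) j)"
  by (auto simp: strand_def coef_sum)

lemma finite_strand_support:
  assumes "f \<in> free_module n"
  shows "finite {c. strand c d f \<noteq> 0}"
proof (rule finite_subset)
  show "{c. strand c d f \<noteq> 0} \<subseteq> (\<Union>j<n. (\<lambda>c. c + d j) ` {c. coef (f j) c \<noteq> 0})"
  proof
    fix c assume "c \<in> {c. strand c d f \<noteq> 0}"
    then obtain j where j: "coef (f j) (c - d j) \<noteq> 0" by (auto simp: strand_def fun_eq_iff)
    then have "j < n" using assms by (force simp: free_module_def not_le[symmetric])
    moreover have "c = (c - d j) + d j" by simp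
    ultimately show "c \<in> (\<Union>j<n. (\<lambda>c. c + d j) ` {c. coef (f j) c \<noteq> 0})" using j by blast
  qed
qed (simp add: finite_coef_support)

text \<open>A homogeneous entry is a scalar times a monomial fixed by the degrees, so the scalar
  matrix induced on a strand does not depend on \<open>c\<close>.\<close>

lemma strand_apply_mat:
  assumes "\<And>k j. k < r \<Longrightarrow> j < s \<Longrightarrow> homogeneous (A k j) (d j - d' k)"
  shows "strand c d' (apply_mat r s A f) = apply_mat r s (\<lambda>k j. coef (A k j) (d j - d' k)) (strand c d f)"
proof
  fix k
  show "strand c d' (apply_mat r s A f) k = apply_mat r s (\<lambda>k j. coef (A k j) (d j - d' k)) (strand c d f) k"
  proof (cases "k < r")
    case True
    have "coef (A k j * f j) (c - d' k) = coef (A k j) (d j - d' k) * coef (f j) (c - d j)" if "j < s" for j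
      using coef_homogeneous_mult[OF assms[OF True that], of "f j" "c - d' k"] by (simp add: algebra_simps)
    then show ?thesis using True by (simp add: strand_def apply_mat_def coef_sum)
  qed (simp add: strand_def apply_mat_def)
qed

text \<open>The module \<open>R\<close> is put in homological degree \<open>0\<close>, so that \<open>F\<^sub>i\<close> gets the index \<open>i + 1\<close> and the
  augmentation becomes the first differential.\<close>

definition rank_of :: "('v, 'k::comm_ring_1) free_complex \<Rightarrow> nat \<Rightarrow> nat" where
  "rank_of F m = (case m of 0 \<Rightarrow> 1 | Suc i \<Rightarrow> num_gens F i)"

definition degree_of :: "('v, 'k::comm_ring_1) free_complex \<Rightarrow> nat \<Rightarrow> nat \<Rightarrow> 'v \<Rightarrow> int" where
  "degree_of F m = (case m of 0 \<Rightarrow> (\<lambda>_. 0) | Suc i \<Rightarrow> gen_deg F i)"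

definition matrix_of :: "('v, 'k::comm_ring_1) free_complex \<Rightarrow> nat \<Rightarrow> nat \<Rightarrow> nat \<Rightarrow> ('v, 'k) mpoly" where
  "matrix_of F m k j = (case m of 0 \<Rightarrow> augm F j | Suc i \<Rightarrow> diff_mat F i k j)"

definition poly_map :: "('v, 'k::comm_ring_1) free_complex \<Rightarrow> nat \<Rightarrow>
    (nat \<Rightarrow> ('v, 'k) mpoly) \<Rightarrow> nat \<Rightarrow> ('v, 'k) mpoly" where
  "poly_map F m = apply_mat (rank_of F m) (rank_of F (Suc m)) (matrix_of F m)"

definition strand_matrix :: "('v::finite, 'k::comm_ring_1) free_complex \<Rightarrow> nat \<Rightarrow> nat \<Rightarrow> nat \<Rightarrow> 'k" where
  "strand_matrix F m k j = coef (matrix_of F m k j) (degree_of F (Suc m) j - degree_of F m k)"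

definition strand_map :: "('v::finite, 'k::comm_ring_1) free_complex \<Rightarrow> nat \<Rightarrow> (nat \<Rightarrow> 'k) \<Rightarrow> nat \<Rightarrow> 'k" where
  "strand_map F m = apply_mat (rank_of F m) (rank_of F (Suc m)) (strand_matrix F m)"

definition homogeneous_complex :: "('v, 'k::comm_ring_1) free_complex \<Rightarrow> bool" where
  "homogeneous_complex F \<longleftrightarrow> (\<forall>m. \<forall>k<rank_of F m. \<forall>j<rank_of F (Suc m).
    homogeneous (matrix_of F m k j) (degree_of F (Suc m) j - degree_of F m k))"

lemma poly_map_in: "poly_map F m f \<in> free_module (rank_of F m)"
  by (simp add: poly_map_def apply_mat_def free_module_def)

lemma poly_map_0: "poly_map F 0 f = (\<lambda>k. if k = 0 then augm_map F f else 0)"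
  by (auto simp: poly_map_def apply_mat_def augm_map_def rank_of_def matrix_of_def)

lemma poly_map_Suc: "poly_map F (Suc i) = diff_map F i"
  by (simp add: poly_map_def diff_map_def rank_of_def matrix_of_def [abs_def])

lemma multigraded_free_resolution_iff:
  "multigraded_free_resolution F I \<longleftrightarrow> homogeneous_complex F \<and>
    augm_map F ` free_module (num_gens F 0) = I \<and>
    (\<forall>m. {f \<in> free_module (rank_of F (Suc m)). poly_map F m f = 0} =
      poly_map F (Suc m) ` free_module (rank_of F (Suc (Suc m))))"
proof -
  have *: "(\<forall>m. P m) \<longleftrightarrow> P 0 \<and> (\<forall>i. P (Suc i))" for P :: "nat \<Rightarrow> bool"
    by (metis nat.exhaust)
  have hom: "homogeneous_complex F \<longleftrightarrow>
    (\<forall>j<num_gens F 0. homogeneous (augm F j) (gen_deg F 0 j)) \<and>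
    (\<forall>i. \<forall>k<num_gens F i. \<forall>j<num_gens F (Suc i).
      homogeneous (diff_mat F i k j) (gen_deg F (Suc i) j - gen_deg F i k))"
    unfolding homogeneous_complex_def *[where P = "\<lambda>m. \<forall>k<rank_of F m. \<forall>j<rank_of F (Suc m).
      homogeneous (matrix_of F m k j) (degree_of F (Suc m) j - degree_of F m k)"]
    by (simp add: rank_of_def degree_of_def matrix_of_def)
  have "poly_map F 0 f = 0 \<longleftrightarrow> augm_map F f = 0" for f by (auto simp: poly_map_0 fun_eq_iff)
  then have ker: "(\<forall>m. {f \<in> free_module (rank_of F (Suc m)). poly_map F m f = 0} =
      poly_map F (Suc m) ` free_module (rank_of F (Suc (Suc m)))) \<longleftrightarrow>
    {f \<in> free_module (num_gens F 0). augm_map F f = 0} = diff_map F 0 ` free_module (num_gens F 1) \<and>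
    (\<forall>i. {f \<in> free_module (num_gens F (Suc i)). diff_map F i f = 0} =
      diff_map F (Suc i) ` free_module (num_gens F (Suc (Suc i))))"
    unfolding *[where P = "\<lambda>m. {f \<in> free_module (rank_of F (Suc m)). poly_map F m f = 0} =
      poly_map F (Suc m) ` free_module (rank_of F (Suc (Suc m)))"]
    by (simp add: poly_map_Suc rank_of_def)
  show ?thesis unfolding multigraded_free_resolution_def hom ker by (simp only: conj_assoc)
qed

lemma strand_poly_map:
  assumes "homogeneous_complex F"
  shows "strand c (degree_of F m) (poly_map F m f) = strand_map F m (strand c (degree_of F (Suc m)) f)"
  unfolding poly_map_def strand_map_def strand_matrix_def [abs_def]
  by (rule strand_apply_mat) (use assms in \<open>auto simp: homogeneous_complex_def\<close>)

abbreviation strand_chains :: "('v::finite, 'k::comm_ring_1) free_complex \<Rightarrow> nat \<Rightarrow> ('v \<Rightarrow> int) \<Rightarrow> (nat \<Rightarrow> 'k) set" where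
  "strand_chains F m \<equiv> filtered_chains (rank_of F m) (degree_of F m)"

definition strand_exact :: "('v::finite, 'k::comm_ring_1) free_complex \<Rightarrow> bool" where
  "strand_exact F \<longleftrightarrow> (\<forall>m c. {a \<in> strand_chains F (Suc m) c. strand_map F m a = 0} =
      strand_map F (Suc m) ` strand_chains F (Suc (Suc m)) c)"

lemma strand_map_zero [simp]: "strand_map F m 0 = 0"
  by (auto simp: strand_map_def apply_mat_def)

lemma strand_map_linear:
  "filtered_linear (rank_of F (Suc m)) (degree_of F (Suc m)) (rank_of F m) (degree_of F m) (strand_map F m)"
  unfolding strand_map_def
  by (rule filtered_linear_apply_mat)
    (auto simp: strand_matrix_def le_fun_def dest!: coef_nonzero_nonneg)

lemma filtered_complex_strand:
  assumes "strand_exact F"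
  shows "filtered_complex (rank_of F) (degree_of F) (strand_map F)"
  using assms by unfold_locales (simp_all add: strand_map_linear strand_exact_def)

text \<open>A strand is put back into the module by \<open>unstrand\<close>, exactness of the
  resolution is used there, and the same strand of the result is taken.\<close>

lemma strand_exact_of_resolution:
  assumes "multigraded_free_resolution F I"
  shows "strand_exact F"
  unfolding strand_exact_def
proof (intro allI equalityI subsetI)
  fix m c a
  have hom: "homogeneous_complex F" and ex: "\<And>m. {f \<in> free_module (rank_of F (Suc m)). poly_map F m f = 0} =
      poly_map F (Suc m) ` free_module (rank_of F (Suc (Suc m)))"
    using assms by (auto simp: multigraded_free_resolution_iff)
  note sp = strand_poly_map[OF hom]
  {
    assume "a \<in> {a \<in> strand_chains F (Suc m) c. strand_map F m a = 0}"
    then have a: "a \<in> strand_chains F (Suc m) c" "strand_map F m a = 0" by auto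
    let ?f = "unstrand c (degree_of F (Suc m)) a"
    have "poly_map F m ?f = 0"
      by (rule strand_eqI[of "degree_of F m"]) (simp add: sp strand_unstrand[OF a(1)] a(2))
    then obtain g where g: "?f = poly_map F (Suc m) g" "g \<in> free_module (rank_of F (Suc (Suc m)))"
      using ex[of m] unstrand_in[OF a(1)] by blast
    have "a = strand c (degree_of F (Suc m)) ?f" by (simp add: strand_unstrand[OF a(1)])
    also have "\<dots> = strand_map F (Suc m) (strand c (degree_of F (Suc (Suc m))) g)"
      unfolding g(1) by (rule sp)
    finally show "a \<in> strand_map F (Suc m) ` strand_chains F (Suc (Suc m)) c"
      using strand_in[OF g(2)] by blast
  next
    assume "a \<in> strand_map F (Suc m) ` strand_chains F (Suc (Suc m)) c"
    then obtain b where b: "b \<in> strand_chains F (Suc (Suc m)) c" "a = strand_map F (Suc m) b" by auto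
    let ?g = "unstrand c (degree_of F (Suc (Suc m))) b"
    have a: "a = strand c (degree_of F (Suc m)) (poly_map F (Suc m) ?g)"
      by (simp add: sp strand_unstrand[OF b(1)] b(2))
    have pg: "poly_map F (Suc m) ?g \<in> free_module (rank_of F (Suc m))" "poly_map F m (poly_map F (Suc m) ?g) = 0"
      using ex[of m] unstrand_in[OF b(1)] by blast+
    have "strand_map F m a = strand c (degree_of F m) (poly_map F m (poly_map F (Suc m) ?g))"
      unfolding a by (rule sp[symmetric])
    then show "a \<in> {a \<in> strand_chains F (Suc m) c. strand_map F m a = 0}"
      using strand_in[OF pg(1)] pg(2) a by simp
  }
qed

text \<open>The right-hand side mentions only the ideal. Two resolutions of one ideal therefore have
  the same image of the first differential on every strand, which starts the comparison.\<close>

lemma strand_image_of_resolution: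
  assumes "multigraded_free_resolution F I"
  shows "strand_map F 0 ` strand_chains F 1 c =
    {a \<in> filtered_chains 1 (\<lambda>_. 0) c. monomial_term c (a 0) \<in> I}"
proof (intro equalityI subsetI)
  have hom: "homogeneous_complex F" and im: "augm_map F ` free_module (num_gens F 0) = I"
    using assms by (auto simp: multigraded_free_resolution_iff)
  note sp = strand_poly_map[OF hom, of _ 0]
  have deg: "degree_of F 0 = (\<lambda>_. 0)" and rk: "rank_of F 0 = 1" "rank_of F 1 = num_gens F 0"
    by (auto simp: degree_of_def rank_of_def)
  fix a
  {
    assume "a \<in> strand_map F 0 ` strand_chains F 1 c"
    then obtain b where b: "b \<in> strand_chains F 1 c" "a = strand_map F 0 b" by auto
    let ?g = "unstrand c (degree_of F 1) b"
    have g: "?g \<in> free_module (num_gens F 0)" using unstrand_in[OF b(1)] rk by simp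
    have st: "strand c' (\<lambda>_. 0) (poly_map F 0 ?g) = (if c' = c then a else 0)" for c'
      using sp[of c' ?g] strand_unstrand[OF b(1), of c'] b(2) deg by auto
    have a: "a \<in> filtered_chains 1 (\<lambda>_. 0) c"
      using strand_in[OF poly_map_in[of F 0 ?g], of c "\<lambda>_. 0"] st[of c] rk by simp
    have "augm_map F ?g = monomial_term c (a 0)"
    proof (rule mpoly_eqI)
      fix c'
      have "a 0 \<noteq> 0 \<Longrightarrow> 0 \<le> c" using a by (auto simp: filtered_chains_def le_fun_def)
      then show "coef (augm_map F ?g) c' = coef (monomial_term c (a 0)) c'"
        using fun_cong[OF st[of c'], of 0] by (auto simp: strand_def poly_map_0 coef_monomial_term)
    qed
    with im g a show "a \<in> {a \<in> filtered_chains 1 (\<lambda>_. 0) c. monomial_term c (a 0) \<in> I}" by force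
  next
    assume "a \<in> {a \<in> filtered_chains 1 (\<lambda>_. 0) c. monomial_term c (a 0) \<in> I}"
    then have a: "a \<in> filtered_chains 1 (\<lambda>_. 0) c" "monomial_term c (a 0) \<in> I" by auto
    then obtain g where g: "g \<in> free_module (num_gens F 0)" "augm_map F g = monomial_term c (a 0)"
      using im by force
    have "strand c (\<lambda>_. 0) (poly_map F 0 g) = a"
      using a(1) g(2)
      by (force simp: strand_def poly_map_0 fun_eq_iff coef_monomial_term filtered_chains_def le_fun_def)
    then have "a = strand_map F 0 (strand c (degree_of F 1) g)" using sp[of c g] deg by simp
    then show "a \<in> strand_map F 0 ` strand_chains F 1 c"
      using strand_in[of g "num_gens F 0" c "degree_of F 1"] g(1) rk by auto
  }
qed

text \<open>Preimages are found strand by strand. Only finitely many strands are nonzero, so placing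
  each preimage back in its degree and summing gives a preimage in the module.\<close>

lemma resolution_of_strand_exact:
  assumes hom: "homogeneous_complex F" and ex: "strand_exact F"
    and im: "augm_map F ` free_module (num_gens F 0) = I"
  shows "multigraded_free_resolution F I"
  unfolding multigraded_free_resolution_iff
proof (intro conjI hom im allI equalityI subsetI)
  fix m f
  note sp = strand_poly_map[OF hom]
  interpret filtered_complex "rank_of F" "degree_of F" "strand_map F"
    by (rule filtered_complex_strand[OF ex])
  {
    assume "f \<in> {f \<in> free_module (rank_of F (Suc m)). poly_map F m f = 0}"
    then have f: "f \<in> free_module (rank_of F (Suc m))" "poly_map F m f = 0" by auto
    let ?st = "\<lambda>c. strand c (degree_of F (Suc m)) f"
    have "strand_map F m (?st c) = 0" for c using sp[of c m f] f(2) by simp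
    then have "\<exists>b\<in>strand_chains F (Suc (Suc m)) c. strand_map F (Suc m) b = ?st c" for c
      using exactD[OF strand_in[OF f(1)]] by force
    then obtain b where b: "\<And>c. b c \<in> strand_chains F (Suc (Suc m)) c"
      "\<And>c. strand_map F (Suc m) (b c) = ?st c"
      by metis
    let ?d = "degree_of F (Suc (Suc m))" and ?S = "{c. ?st c \<noteq> 0}"
    define g where "g = (\<lambda>j. \<Sum>c\<in>?S. unstrand c ?d (b c) j)"
    have fin: "finite ?S" by (rule finite_strand_support[OF f(1)])
    have "g \<in> free_module (rank_of F (Suc (Suc m)))"
      using unstrand_in[OF b(1)] by (auto simp: g_def free_module_def)
    moreover have "poly_map F (Suc m) g = f"
    proof (rule strand_eqI)
      fix c
      have "strand c ?d g = (\<lambda>j. \<Sum>c'\<in>?S. if c' = c then b c j else 0)"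
        unfolding g_def strand_sum
        by (intro ext sum.cong) (auto simp: strand_unstrand[OF b(1)])
      then have "strand c ?d g = (if ?st c = 0 then 0 else b c)"
        using fin by (cases "?st c = 0") (simp_all add: zero_fun_def)
      then show "strand c (degree_of F (Suc m)) (poly_map F (Suc m) g) = ?st c"
        by (simp add: sp b(2))
    qed
    ultimately show "f \<in> poly_map F (Suc m) ` free_module (rank_of F (Suc (Suc m)))" by blast
  next
    assume "f \<in> poly_map F (Suc m) ` free_module (rank_of F (Suc (Suc m)))"
    then obtain g where g: "g \<in> free_module (rank_of F (Suc (Suc m)))" "f = poly_map F (Suc m) g" by auto
    have "poly_map F m f = 0"
      by (rule strand_eqI[of "degree_of F m"]) (simp add: sp g(2) D_D[OF strand_in[OF g(1)]])
    then show "f \<in> {f \<in> free_module (rank_of F (Suc m)). poly_map F m f = 0}"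
      using poly_map_in g(2) by auto
  }
qed


section \<open>Independence of the resolution\<close>

context filtered_complex begin

lemma graded_diff_add: "graded_diff m b (x + y) = graded_diff m b x + graded_diff m b y"
  by (simp add: graded_diff_def filtered_linearD(1)[OF D_linear] degree_part_add)

lemma graded_diff_scale: "graded_diff m b (\<lambda>j. r * x j) = (\<lambda>j. r * graded_diff m b x j)"
  by (auto simp: graded_diff_def filtered_linearD(2)[OF D_linear] degree_part_def)

lemma graded_diff_zero: "graded_diff m b 0 = 0"
  by (simp add: graded_diff_def filtered_linearD(4)[OF D_linear])

end

interpretation chain_space: vector_space "\<lambda>(r::'k::field) (f::nat \<Rightarrow> 'k) j. r * f j"
  by unfold_locales (simp_all add: fun_eq_iff algebra_simps)

lemma subspace_degree_chains: "chain_space.subspace (degree_chains n d b)"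
  by (rule chain_space.subspaceI) (auto simp: degree_chains_def, (metis add.right_neutral)+)

lemma degree_chains_span:
  "(degree_chains n d b :: (nat \<Rightarrow> 'k::field) set) \<subseteq> chain_space.span (unit_chain ` {..<n})"
proof
  fix a :: "nat \<Rightarrow> 'k" assume "a \<in> degree_chains n d b"
  then have "a = (\<Sum>j<n. (\<lambda>i. a j * unit_chain j i))"
    by (rule filtered_chains_expand[OF degree_chains_filtered])
  also have "\<dots> \<in> chain_space.span (unit_chain ` {..<n})"
    by (intro chain_space.span_sum chain_space.span_scale chain_space.span_base) auto
  finally show "a \<in> chain_space.span (unit_chain ` {..<n})" .
qed

text \<open>Subtraction of natural numbers only yields an inequality of dimensions. An element of
  \<open>Z\<close> outside \<open>B\<close> would extend a basis of \<open>B\<close> to an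
  independent set too large for \<open>Z\<close>.\<close>

lemma dim_K_diff_eq_0_iff:
  assumes B: "chain_space.subspace B" and "B \<subseteq> Z"
    and fin: "finite S" "Z \<subseteq> chain_space.span S"
  shows "dim_K Z - dim_K B = 0 \<longleftrightarrow> Z = B"
proof
  assume le: "dim_K Z - dim_K B = 0"
  obtain bB where bB: "bB \<subseteq> B" "chain_space.independent bB" "B \<subseteq> chain_space.span bB" "card bB = dim_K B"
    unfolding dim_K_def by (rule chain_space.basis_exists)
  obtain bZ where bZ: "bZ \<subseteq> Z" "chain_space.independent bZ" "Z \<subseteq> chain_space.span bZ" "card bZ = dim_K Z"
    unfolding dim_K_def by (rule chain_space.basis_exists)
  have finZ: "finite bZ"
    using chain_space.independent_span_bound[OF fin(1) bZ(2)] bZ(1) fin(2) by auto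
  have "z \<in> B" if z: "z \<in> Z" for z
  proof (rule ccontr)
    assume "z \<notin> B"
    then have "z \<notin> chain_space.span bB" using chain_space.span_minimal[OF bB(1) B] by auto
    moreover from this have "z \<notin> bB" using chain_space.span_base by blast
    ultimately have ind: "chain_space.independent (insert z bB)" and "z \<notin> bB"
      using bB(2) by (simp_all add: chain_space.independent_insert)
    have "insert z bB \<subseteq> chain_space.span bZ" using z bB(1) assms(2) bZ(3) by auto
    from chain_space.independent_span_bound[OF finZ ind this]
    have "finite (insert z bB)" "card (insert z bB) \<le> dim_K Z" using bZ(4) by simp_all
    then show False using le bB(4) \<open>z \<notin> bB\<close> by simp
  qed
  then show "Z = B" using assms(2) by auto
qed simp

lemma tensor_chains_eq: "tensor_chains F i b = degree_chains (num_gens F i) (gen_deg F i) b"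
proof -
  have "f \<in> free_module r \<longleftrightarrow> (\<forall>j. f j \<noteq> 0 \<longrightarrow> j < r)" for f :: "nat \<Rightarrow> 'a" and r
    by (auto simp: free_module_def not_le[symmetric])
  then show ?thesis by (auto simp: tensor_chains_def degree_chains_def)
qed

text \<open>On chains concentrated in degree \<open>b\<close> both sides see only the entries
  between generators of degree \<open>b\<close>, and such entries are constants.\<close>

lemma tensor_diff_eq:
  fixes F :: "('v::finite, 'k::field) free_complex"
  assumes hom: "homogeneous_complex F" and a: "a \<in> tensor_chains F (Suc i) b"
  shows "tensor_diff F i a = degree_part (gen_deg F i) b (strand_map F (Suc i) a)"
proof
  fix k
  have "Poly_Mapping.lookup (diff_mat F i k j) 0 * a j =
      (if gen_deg F i k = b then strand_matrix F (Suc i) k j * a j else 0)"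
    if "k < num_gens F i" "j < num_gens F (Suc i)" for j
  proof (cases "a j = 0")
    case False
    then have "gen_deg F (Suc i) j = b" using a by (auto simp: tensor_chains_def)
    moreover have "homogeneous (diff_mat F i k j) (gen_deg F (Suc i) j - gen_deg F i k)"
      using hom[unfolded homogeneous_complex_def, rule_format, of k "Suc i" j] that
      by (simp add: rank_of_def degree_of_def matrix_of_def)
    ultimately show ?thesis
      by (auto simp: homogeneous_lookup_zero strand_matrix_def degree_of_def matrix_of_def)
  qed simp
  then show "tensor_diff F i a k = degree_part (gen_deg F i) b (strand_map F (Suc i) a) k"
    by (auto simp: tensor_diff_def strand_map_def apply_mat_def degree_part_def rank_of_def)
qed

lemma tensor_homology_eq:
  fixes F :: "('v::finite, 'k::field) free_complex"
  assumes hom: "homogeneous_complex F" and ex: "strand_exact F"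
  shows "tensor_cycles F i b = filtered_complex.graded_cycles (rank_of F) (degree_of F) (strand_map F) i b"
    and "tensor_boundaries F i b = filtered_complex.graded_boundaries (rank_of F) (degree_of F) (strand_map F) i b"
proof -
  interpret filtered_complex "rank_of F" "degree_of F" "strand_map F"
    by (rule filtered_complex_strand[OF ex])
  have deg: "degree_of F (Suc i) = gen_deg F i" "rank_of F (Suc i) = num_gens F i" for i
    by (simp_all add: degree_of_def rank_of_def)
  have diff: "tensor_diff F i a = graded_diff (Suc i) b a" if "a \<in> tensor_chains F (Suc i) b" for a i
    using tensor_diff_eq[OF hom that] by (simp add: graded_diff_def deg)
  show "tensor_cycles F i b = graded_cycles i b"
    using diff by (cases i) (auto simp: tensor_cycles_def graded_cycles_def tensor_chains_eq deg)
  show "tensor_boundaries F i b = graded_boundaries i b"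
    unfolding tensor_boundaries_def graded_boundaries_def deg tensor_chains_eq[symmetric]
    by (rule image_cong) (auto simp: diff)
qed

lemma tensor_homology_nonzero_iff:
  fixes F :: "('v::finite, 'k::field) free_complex"
  assumes hom: "homogeneous_complex F" and ex: "strand_exact F"
  shows "dim_K (tensor_cycles F i b) - dim_K (tensor_boundaries F i b) \<noteq> 0 \<longleftrightarrow>
    tensor_cycles F i b \<noteq> tensor_boundaries F i b"
proof -
  interpret filtered_complex "rank_of F" "degree_of F" "strand_map F"
    by (rule filtered_complex_strand[OF ex])
  let ?C = "degree_chains (rank_of F (Suc (Suc i))) (degree_of F (Suc (Suc i))) b"
  have "chain_space.subspace (graded_boundaries i b)"
  proof (rule chain_space.subspaceI)
    show "0 \<in> graded_boundaries i b"
      unfolding graded_boundaries_def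
      by (rule image_eqI[of _ _ 0]) (simp_all add: graded_diff_zero chain_space.subspace_0[OF subspace_degree_chains])
    show "x + y \<in> graded_boundaries i b" if xy: "x \<in> graded_boundaries i b" "y \<in> graded_boundaries i b" for x y
    proof -
      obtain x' y' where "x' \<in> ?C" "y' \<in> ?C" "x = graded_diff (Suc i) b x'" "y = graded_diff (Suc i) b y'"
        using xy by (auto simp: graded_boundaries_def)
      then show ?thesis
        unfolding graded_boundaries_def
        by (intro image_eqI[of _ _ "x' + y'"] chain_space.subspace_add[OF subspace_degree_chains])
          (simp_all add: graded_diff_add)
    qed
    show "(\<lambda>j. r * x j) \<in> graded_boundaries i b" if x: "x \<in> graded_boundaries i b" for r x
    proof -
      obtain x' where "x' \<in> ?C" "x = graded_diff (Suc i) b x'"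
        using x by (auto simp: graded_boundaries_def)
      then show ?thesis
        unfolding graded_boundaries_def
        by (intro image_eqI[of _ _ "\<lambda>j. r * x' j"] chain_space.subspace_scale[OF subspace_degree_chains])
          (simp_all add: graded_diff_scale)
    qed
  qed
  moreover have "finite (unit_chain ` {..<rank_of F (Suc i)} :: (nat \<Rightarrow> 'k) set)" by simp
  moreover have "graded_cycles i b \<subseteq> chain_space.span (unit_chain ` {..<rank_of F (Suc i)})"
    using degree_chains_span unfolding graded_cycles_def by blast
  ultimately show ?thesis
    unfolding tensor_homology_eq[OF hom ex]
    by (simp only: dim_K_diff_eq_0_iff[OF _ graded_boundaries_subset] not_False_eq_True)
qed

text \<open>The resolution behind \<open>betti\<close> is unspecified; \<open>G\<close> shows that
  there is one, and exactness of a graded piece transfers from either resolution to the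
  other.\<close>

theorem betti_nonzero_iff:
  fixes G :: "('v::finite, 'k::field) free_complex"
  assumes G: "multigraded_free_resolution G I"
  shows "betti I i b \<noteq> 0 \<longleftrightarrow> tensor_cycles G i b \<noteq> tensor_boundaries G i b"
proof -
  define F :: "('v, 'k) free_complex" where "F = (SOME F. multigraded_free_resolution F I)"
  have F: "multigraded_free_resolution F I" unfolding F_def by (rule someI[of _ G]) (rule G)
  have hom: "homogeneous_complex F" "homogeneous_complex G"
    using F G by (auto simp: multigraded_free_resolution_iff)
  note ex = strand_exact_of_resolution[OF F] strand_exact_of_resolution[OF G]
  note fc = filtered_complex_strand[OF ex(1)] filtered_complex_strand[OF ex(2)]
  have 0: "rank_of F 0 = rank_of G 0" "degree_of F 0 = degree_of G 0"
    by (simp_all add: rank_of_def degree_of_def)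
  have im: "strand_map F 0 ` strand_chains F 1 c = strand_map G 0 ` strand_chains G 1 c" for c
    unfolding strand_image_of_resolution[OF F] strand_image_of_resolution[OF G] ..
  have "betti I i b = dim_K (tensor_cycles F i b) - dim_K (tensor_boundaries F i b)"
    by (simp add: betti_def F_def Let_def)
  then have "betti I i b \<noteq> 0 \<longleftrightarrow> tensor_cycles F i b \<noteq> tensor_boundaries F i b"
    using tensor_homology_nonzero_iff[OF hom(1) ex(1)] by simp
  also have "\<dots> \<longleftrightarrow> tensor_cycles G i b \<noteq> tensor_boundaries G i b"
    using graded_exactness_transfer[OF fc 0 im] graded_exactness_transfer[OF fc(2,1) 0[symmetric] im[symmetric]]
    unfolding tensor_homology_eq[OF hom(1) ex(1)] tensor_homology_eq[OF hom(2) ex(2)] by blast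
  finally show ?thesis .
qed


section \<open>The cubical resolution\<close>

definition dim_cells :: "'n::finite set set \<Rightarrow> nat \<Rightarrow> ('n set \<times> 'n set set) set" where
  "dim_cells L i = {x \<in> cells L. card (snd x) = i}"

definition enum_cell :: "'n::finite set set \<Rightarrow> nat \<Rightarrow> nat \<Rightarrow> 'n set \<times> 'n set set" where
  "enum_cell L i = (SOME e. bij_betw e {..<card (dim_cells L i)} (dim_cells L i))"

definition cell_degree :: "'n set \<times> 'n set set \<Rightarrow> 'n vertex \<Rightarrow> int" where
  "cell_degree x v = (case v of Inl i \<Rightarrow> if i \<in> fst x then 1 else 0
    | Inr j \<Rightarrow> if j \<in> fst x - \<Union>(snd x) then 0 else 1)"

text \<open>A cellular resolution: each incidence number is made homogeneous by the monomial whose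
  degree is the difference of the cell degrees. The numbering of the bases is arbitrary.\<close>

definition cell_resolution :: "'n::finite set set \<Rightarrow> ('n vertex, 'k::comm_ring_1) free_complex" where
  "cell_resolution L = \<lparr>
    num_gens = \<lambda>i. card (dim_cells L i),
    gen_deg = \<lambda>i j. cell_degree (enum_cell L i j),
    diff_mat = \<lambda>i k j. monomial_term (cell_degree (enum_cell L (Suc i) j) - cell_degree (enum_cell L i k))
      (cell_bd (enum_cell L (Suc i) j) (enum_cell L i k)),
    augm = \<lambda>j. monomial_term (cell_degree (enum_cell L 0 j)) 1\<rparr>"

lemma enum_cell: "bij_betw (enum_cell L i) {..<card (dim_cells L i)} (dim_cells L i)"
  unfolding enum_cell_def
proof (rule someI_ex[of "\<lambda>e. bij_betw e {..<card (dim_cells L i)} (dim_cells L i)"])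
  have "finite (dim_cells L i)" by simp
  from ex_bij_betw_nat_finite[OF this]
  show "\<exists>e. bij_betw e {..<card (dim_cells L i)} (dim_cells L i)" unfolding atLeast0LessThan .
qed

lemma enum_cell_in:
  assumes "j < card (dim_cells L i)"
  shows "enum_cell L i j \<in> dim_cells L i"
proof (rule bij_betw_apply[OF enum_cell])
  show "j \<in> {..<card (dim_cells L i)}" using assms by (simp only: lessThan_iff)
qed

lemma dim_cells_enumE:
  assumes "x \<in> dim_cells L i"
  obtains j where "j < card (dim_cells L i)" "x = enum_cell L i j"
proof -
  have "x \<in> enum_cell L i ` {..<card (dim_cells L i)}"
    using assms by (simp add: bij_betw_imp_surj_on[OF enum_cell])
  with that show thesis by auto
qed

section \<open>Multidegrees of cells\<close>

lemma cell_degree_nonneg: "0 \<le> cell_degree x"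
proof (rule le_funI)
  show "0 v \<le> cell_degree x v" for v by (cases v) (simp_all add: cell_degree_def)
qed

lemma cell_degree_le_iff:
  "cell_degree x \<le> cell_degree y \<longleftrightarrow> fst x \<subseteq> fst y \<and> fst y - \<Union>(snd y) \<subseteq> fst x - \<Union>(snd x)"
proof -
  have "(if b then 1 else 0 :: int) \<le> (if b' then 1 else 0) \<longleftrightarrow> (b \<longrightarrow> b')"
    "(if b then 0 else 1 :: int) \<le> (if b' then 0 else 1) \<longleftrightarrow> (b' \<longrightarrow> b)" for b b'
    by auto
  then have "cell_degree x \<le> cell_degree y \<longleftrightarrow> (\<forall>i. i \<in> fst x \<longrightarrow> i \<in> fst y) \<and>
      (\<forall>j. j \<in> fst y - \<Union>(snd y) \<longrightarrow> j \<in> fst x - \<Union>(snd x))"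
    unfolding le_fun_def cell_degree_def split_sum_all by (simp only: sum.case)
  then show ?thesis unfolding subset_iff .
qed

text \<open>Cell degrees are 0-1 vectors, so only the positivity of the entries of \<open>c\<close>
  matters: the x-entries bound the top from above, the y-entries bound the bottom from
  below.\<close>

lemma cell_degree_le_multidegree_iff:
  assumes "0 \<le> c"
  shows "cell_degree x \<le> c \<longleftrightarrow>
    {j. c (yv j) < 1} \<subseteq> fst x - \<Union>(snd x) \<and> fst x \<subseteq> {i. 1 \<le> c (xv i)}"
proof -
  have "0 \<le> c v" for v using assms by (simp add: le_fun_def)
  moreover have "(if b then 1 else 0) \<le> z \<longleftrightarrow> (b \<longrightarrow> 1 \<le> z)" "(if b then 0 else 1) \<le> z \<longleftrightarrow> (\<not> b \<longrightarrow> 1 \<le> z)"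
    if "0 \<le> z" for z :: int and b using that by auto
  ultimately have "cell_degree x \<le> c \<longleftrightarrow>
      (\<forall>i. i \<in> fst x \<longrightarrow> 1 \<le> c (xv i)) \<and> (\<forall>j. j \<notin> fst x - \<Union>(snd x) \<longrightarrow> 1 \<le> c (yv j))"
    unfolding le_fun_def cell_degree_def split_sum_all by simp
  also have "\<dots> \<longleftrightarrow> {j. c (yv j) < 1} \<subseteq> fst x - \<Union>(snd x) \<and> fst x \<subseteq> {i. 1 \<le> c (xv i)}"
    unfolding subset_iff mem_Collect_eq not_le[symmetric] by blast
  finally show ?thesis .
qed

text \<open>The top contributes its size and the complement of the bottom contributes n minus the
  size of the bottom; top and bottom differ by the union of the blocks.\<close>

lemma sum_cell_degree:
  fixes x :: "'n::finite set \<times> 'n set set"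
  assumes "x \<in> cells L"
  shows "sum (cell_degree x) UNIV = int (card (UNIV :: 'n set)) + int (card (\<Union>(snd x)))"
proof -
  let ?p = "fst x" and ?U = "\<Union>(snd x)"
  have U: "?U \<subseteq> ?p" using assms by (auto simp: cells_def blocks_def)
  have compl: "(\<Sum>j\<in>UNIV. if j \<in> A then 0 else 1 :: int) = int (card (- A))" for A :: "'n set"
    by (simp add: sum.If_cases)
  have "sum (cell_degree x) UNIV = (\<Sum>i\<in>UNIV. if i \<in> ?p then 1 else 0) + (\<Sum>j\<in>UNIV. if j \<in> ?p - ?U then 0 else 1)"
    unfolding UNIV_sum by (subst sum.union_disjoint) (auto simp: sum.reindex cell_degree_def)
  also have "(\<Sum>i\<in>UNIV. if i \<in> ?p then 1 else 0 :: int) = int (card ?p)"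
    by (simp add: sum.If_cases)
  also have "(\<Sum>j\<in>UNIV. if j \<in> ?p - ?U then 0 else 1 :: int) = int (card (- (?p - ?U)))"
    by (rule compl)
  also have "card (- (?p - ?U)) = card (UNIV :: 'n set) - card (?p - ?U)"
    by (simp add: Compl_eq_Diff_UNIV card_Diff_subset)
  also have "card (?p - ?U) = card ?p - card ?U" using U by (simp add: card_Diff_subset)
  finally show ?thesis using U card_mono[OF _ U] card_mono[of UNIV ?p] by simp
qed

lemma cell_degree_cover: "cell_degree (p, {}) = cover_multideg p"
proof
  show "cell_degree (p, {}) v = cover_multideg p v" for v
    by (cases v) (simp_all add: cell_degree_def cover_multideg_def)
qed

lemma cover_monomial_eq:
  "(cover_monomial p :: ('n::finite vertex, 'k::comm_ring_1) mpoly) = monomial_term (cover_multideg p) 1"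
proof -
  obtain m where m: "(cover_monomial p :: ('n vertex, 'k) mpoly) = Poly_Mapping.single m 1"
    "\<And>v. int (Poly_Mapping.lookup m v) = cover_multideg p v"
    by (rule cover_monomial_multideg) blast
  have "cover_multideg p = (\<lambda>v. int (Poly_Mapping.lookup m v))" using m(2) by auto
  then show ?thesis using m(1) by (simp add: monomial_term_def le_fun_def)
qed

context set_lattice begin

text \<open>The upper facet loses y-variables, the lower facet loses x-variables. The weak
  inequality keeps \<open>monomial_term\<close> from cutting off nonzero entries of the resolution;
  the strict one gives minimality.\<close>

lemma cell_bd_degree:
  assumes "x \<in> cells L" "cell_bd x y \<noteq> (0::'k::comm_ring_1)"
  shows "cell_degree y \<le> cell_degree x" "cell_degree y \<noteq> cell_degree x"
proof -
  obtain p T q U where xy: "x = (p, T)" "y = (q, U)" by (cases x, cases y)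
  then obtain B where B: "B \<in> T" "U = T - {B}" "q = p \<or> q = p - B"
    using assms(2) cell_bd_nonzeroD by metis
  have c: "(p, T) \<in> cells L" using assms(1) xy by simp
  note f = cell_face(3-6)[OF c B(1)]
  show "cell_degree y \<le> cell_degree x"
    unfolding cell_degree_le_iff xy fst_conv snd_conv using B(2,3) f(1,2) by blast
  have "\<not> (p \<subseteq> q \<and> q - \<Union>U \<subseteq> p - \<Union>T)"
    using B(3) f(2-4) unfolding B(2) by blast
  then show "cell_degree y \<noteq> cell_degree x"
    using cell_degree_le_iff[of x y] xy by auto
qed

section \<open>The cubical complex as a minimal resolution\<close>

abbreviation "\<F> \<equiv> cell_resolution L :: ('n vertex, 'k::comm_ring_1) free_complex"

lemma cell_resolution_simps [simp]:
  "rank_of \<F> (Suc i) = card (dim_cells L i)" "rank_of \<F> 0 = 1"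
  "degree_of \<F> (Suc i) = (\<lambda>j. cell_degree (enum_cell L i j))" "degree_of \<F> 0 = (\<lambda>j. 0)"
  "num_gens \<F> i = card (dim_cells L i)" "gen_deg \<F> i = (\<lambda>j. cell_degree (enum_cell L i j))"
  by (simp_all add: rank_of_def degree_of_def cell_resolution_def)

lemma homogeneous_cell_resolution: "homogeneous_complex \<F>"
  unfolding homogeneous_complex_def
proof (intro allI impI)
  fix m k j
  show "homogeneous (matrix_of \<F> m k j) (degree_of \<F> (Suc m) j - degree_of \<F> m k)"
    by (cases m) (simp_all add: matrix_of_def homogeneous_monomial_term,
      simp_all add: cell_resolution_def homogeneous_monomial_term)
qed

lemma strand_matrix_cell_resolution:
  "strand_matrix \<F> 0 k j = (1::'k::comm_ring_1)"
  "j < card (dim_cells L (Suc i)) \<Longrightarrow>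
    strand_matrix \<F> (Suc i) k j = (cell_bd (enum_cell L (Suc i) j) (enum_cell L i k) :: 'k::comm_ring_1)"
proof -
  show "strand_matrix \<F> 0 k j = (1::'k)"
    by (simp add: strand_matrix_def matrix_of_def)
      (simp add: cell_resolution_def coef_monomial_term cell_degree_nonneg)
  assume j: "j < card (dim_cells L (Suc i))"
  have x: "enum_cell L (Suc i) j \<in> cells L" using enum_cell_in[OF j] by (simp add: dim_cells_def)
  show "strand_matrix \<F> (Suc i) k j = (cell_bd (enum_cell L (Suc i) j) (enum_cell L i k) :: 'k)"
    using cell_bd_degree(1)[OF x, of "enum_cell L i k", where ?'k = 'k]
    by (simp add: strand_matrix_def matrix_of_def) (auto simp: cell_resolution_def coef_monomial_term)
qed

text \<open>Translates coordinate vectors in the numbered basis back to chains on cells, where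
  exactness is available.\<close>

definition to_cells :: "nat \<Rightarrow> (nat \<Rightarrow> 'k::comm_ring_1) \<Rightarrow> 'n set \<times> 'n set set \<Rightarrow> 'k" where
  "to_cells i a x =
    (if x \<in> dim_cells L i then a (the_inv_into {..<card (dim_cells L i)} (enum_cell L i) x) else 0)"

lemma to_cells_enum: "j < card (dim_cells L i) \<Longrightarrow> to_cells i a (enum_cell L i j) = a j"
  using enum_cell_in[of j L i] enum_cell[of L i]
  by (simp add: to_cells_def the_inv_into_f_f bij_betw_def)

lemma to_cells_nonzeroD:
  assumes "to_cells i a x \<noteq> 0"
  obtains j where "j < card (dim_cells L i)" "x = enum_cell L i j" "a j \<noteq> 0"
proof -
  have "x \<in> dim_cells L i" using assms by (auto simp: to_cells_def split: if_splits)
  then obtain j where "j < card (dim_cells L i)" "x = enum_cell L i j" by (rule dim_cells_enumE)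
  with assms to_cells_enum[of j i a] show thesis by (intro that) auto
qed

lemma sum_enum_cell:
  "(\<Sum>j<card (dim_cells L i). g (enum_cell L i j) * a j) = (\<Sum>x\<in>cells L. g x * (to_cells i a x :: 'k::comm_ring_1))"
proof -
  have "(\<Sum>j<card (dim_cells L i). g (enum_cell L i j) * a j) =
      (\<Sum>j<card (dim_cells L i). g (enum_cell L i j) * to_cells i a (enum_cell L i j))"
    by (rule sum.cong) (auto simp: to_cells_enum)
  also have "\<dots> = (\<Sum>x\<in>dim_cells L i. g x * to_cells i a x)"
    by (rule sum.reindex_bij_betw[OF enum_cell])
  also have "\<dots> = (\<Sum>x\<in>cells L. g x * to_cells i a x)"
    by (rule sum.mono_neutral_left) (auto simp: dim_cells_def to_cells_def)
  finally show ?thesis .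
qed

lemma strand_map_cell_resolution_0: "strand_map \<F> 0 a 0 = (cell_aug L (to_cells 0 a) :: 'k::comm_ring_1)"
proof -
  have "cell_aug L (to_cells 0 a) = (\<Sum>x\<in>cells L. 1 * to_cells 0 a x)"
    unfolding cell_aug_def by (simp, rule sum.mono_neutral_left) (auto simp: to_cells_def dim_cells_def)
  then show ?thesis
    unfolding sum_enum_cell[symmetric]
    by (simp add: strand_map_def apply_mat_def strand_matrix_cell_resolution)
qed

lemma strand_map_cell_resolution_Suc:
  assumes "k < card (dim_cells L i)"
  shows "strand_map \<F> (Suc i) a k = (cell_diff L (to_cells (Suc i) a) (enum_cell L i k) :: 'k::comm_ring_1)"
proof -
  have "strand_map \<F> (Suc i) a k =
      (\<Sum>j<card (dim_cells L (Suc i)). strand_matrix \<F> (Suc i) k j * a j)"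
    using assms by (simp add: strand_map_def apply_mat_def)
  also have "\<dots> =
      (\<Sum>j<card (dim_cells L (Suc i)). cell_bd (enum_cell L (Suc i) j) (enum_cell L i k) * a j)"
    by (rule sum.cong) (simp_all add: strand_matrix_cell_resolution)
  also have "\<dots> = (\<Sum>x\<in>cells L. cell_bd x (enum_cell L i k) * to_cells (Suc i) a x)"
    by (rule sum_enum_cell)
  also have "\<dots> = cell_diff L (to_cells (Suc i) a) (enum_cell L i k)"
    unfolding cell_diff_def by (rule sum.cong) (simp_all add: mult.commute)
  finally show ?thesis .
qed

lemma to_cells_supp:
  assumes a: "a \<in> strand_chains \<F> (Suc i) c" and "0 \<le> c" and "to_cells i a x \<noteq> (0::'k::comm_ring_1)"
  shows "x \<in> interval_cells L {j. c (yv j) < 1} {i. 1 \<le> c (xv i)} i"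
proof -
  obtain j where j: "j < card (dim_cells L i)" "x = enum_cell L i j" "a j \<noteq> 0"
    using assms(3) by (rule to_cells_nonzeroD)
  then have "cell_degree x \<le> c" using a by (simp add: filtered_chains_def)
  then show ?thesis
    using enum_cell_in[OF j(1)] j(2) cell_degree_le_multidegree_iff[OF assms(2), of x]
    by (simp add: interval_cells_def dim_cells_def)
qed

lemma to_cells_strand_map:
  assumes a: "a \<in> strand_chains \<F> (Suc (Suc i)) c"
  shows "to_cells i (strand_map \<F> (Suc i) a) = (cell_diff L (to_cells (Suc i) a) :: _ \<Rightarrow> 'k::comm_ring_1)"
proof
  fix x
  show "to_cells i (strand_map \<F> (Suc i) a) x = cell_diff L (to_cells (Suc i) a) x"
  proof (cases "x \<in> dim_cells L i")
    case True
    then obtain k where "k < card (dim_cells L i)" "x = enum_cell L i k" by (rule dim_cells_enumE)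
    then show ?thesis by (simp add: to_cells_enum strand_map_cell_resolution_Suc)
  next
    case False
    have "cell_diff L (to_cells (Suc i) a) x = 0"
    proof (rule ccontr)
      assume nz: "cell_diff L (to_cells (Suc i) a) x \<noteq> 0"
      have supp: "z \<in> interval_cells L {} UNIV (Suc i)" if "to_cells (Suc i) a z \<noteq> 0" for z
        using that by (auto simp: to_cells_def dim_cells_def interval_cells_def split: if_splits)
      show False
        by (rule cell_diff_interval_cells[OF supp nz])
          (use False in \<open>auto simp: interval_cells_def dim_cells_def\<close>)
    qed
    moreover have "to_cells i (strand_map \<F> (Suc i) a) x = 0" using False by (simp only: to_cells_def if_False)
    ultimately show ?thesis by (simp only:)
  qed
qed

lemma strand_map_cell_resolution_eq_0_iff:
  "a \<in> strand_chains \<F> (Suc i) c \<Longrightarrow> strand_map \<F> i a = 0 \<longleftrightarrow>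
    (if i = 0 then cell_aug L (to_cells i a) = (0::'k::comm_ring_1) else \<forall>y. cell_diff L (to_cells i a) y = 0)"
proof (cases i)
  case 0
  have "strand_map \<F> 0 a k = 0" if "k \<noteq> 0" for k using that by (simp add: strand_map_def apply_mat_def)
  then have "(\<forall>k. strand_map \<F> 0 a k = 0) \<longleftrightarrow> strand_map \<F> 0 a 0 = 0" by metis
  then have "strand_map \<F> 0 a = 0 \<longleftrightarrow> strand_map \<F> 0 a 0 = 0" by (simp add: fun_eq_iff)
  then show ?thesis using 0 by (simp add: strand_map_cell_resolution_0)
next
  case (Suc l)
  assume a: "a \<in> strand_chains \<F> (Suc i) c"
  show ?thesis
  proof
    assume "strand_map \<F> i a = 0"
    then have "cell_diff L (to_cells i a) y = to_cells l 0 y" for y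
      using to_cells_strand_map[of a l c] a Suc by simp
    then show "if i = 0 then cell_aug L (to_cells i a) = 0 else \<forall>y. cell_diff L (to_cells i a) y = 0"
      using Suc by (simp add: to_cells_def)
  next
    assume "if i = 0 then cell_aug L (to_cells i a) = 0 else \<forall>y. cell_diff L (to_cells i a) y = 0"
    then have z: "cell_diff L (to_cells (Suc l) a) y = 0" for y using Suc by (simp del: split_paired_All)
    have "strand_map \<F> (Suc l) a k = 0" for k
    proof (cases "k < card (dim_cells L l)")
      case True
      then show ?thesis by (simp add: strand_map_cell_resolution_Suc z)
    qed (simp add: strand_map_def apply_mat_def)
    then show "strand_map \<F> i a = 0" using Suc by (auto simp: fun_eq_iff)
  qed
qed

lemma strand_exact_cell_resolution: "strand_exact (\<F> :: ('n vertex, 'k::comm_ring_1) free_complex)"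
  unfolding strand_exact_def
proof (intro allI equalityI subsetI)
  fix i c and a :: "nat \<Rightarrow> 'k"
  {
    assume "a \<in> {a \<in> strand_chains \<F> (Suc i) c. strand_map \<F> i a = 0}"
    then have a: "a \<in> strand_chains \<F> (Suc i) c" and cyc: "strand_map \<F> i a = 0" by auto
    show "a \<in> strand_map \<F> (Suc i) ` strand_chains \<F> (Suc (Suc i)) c"
    proof (cases "a = 0")
      case True
      then show ?thesis by (intro image_eqI[of _ _ 0]) simp_all
    next
      case False
      then obtain j where "a j \<noteq> 0" by (auto simp: fun_eq_iff)
      then have "cell_degree (enum_cell L i j) \<le> c" using a by (simp add: filtered_chains_def)
      \<comment> \<open>A nonzero chain uses a cell of degree at most \<open>c\<close>, so
        \<open>c\<close> is nonnegative, as the translation of the degree bound into an interval of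
        sets demands.\<close>
      then have c: "0 \<le> c" using cell_degree_nonneg order_trans by blast
      let ?I = "interval_cells L {j. c (yv j) < 1} {i. 1 \<le> c (xv i)}"
      obtain b where b: "\<And>x. b x \<noteq> 0 \<Longrightarrow> x \<in> ?I (Suc i)" "\<And>y. cell_diff L b y = to_cells i a y"
        by (rule cell_complex_exact[OF to_cells_supp[OF a c]
          cyc[unfolded strand_map_cell_resolution_eq_0_iff[OF a]]]) blast+
      define b' where "b' j = (if j < card (dim_cells L (Suc i)) then b (enum_cell L (Suc i) j) else 0)" for j
      have "b' \<in> strand_chains \<F> (Suc (Suc i)) c"
        using b(1)
        by (auto simp: filtered_chains_def b'_def interval_cells_def cell_degree_le_multidegree_iff[OF c])
      moreover have "to_cells (Suc i) b' = b"
      proof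
        fix x
        show "to_cells (Suc i) b' x = b x"
        proof (cases "x \<in> dim_cells L (Suc i)")
          case True
          then obtain k where "k < card (dim_cells L (Suc i))" "x = enum_cell L (Suc i) k"
            by (rule dim_cells_enumE)
          then show ?thesis by (simp add: to_cells_enum b'_def)
        next
          case False
          then show ?thesis using b(1)[of x] by (auto simp: to_cells_def dim_cells_def interval_cells_def)
        qed
      qed
      then have "strand_map \<F> (Suc i) b' k = a k" for k
      proof (cases "k < card (dim_cells L i)")
        case False
        then have "a k = 0" using a by (auto simp: filtered_chains_def)
        with False show ?thesis by (simp add: strand_map_def apply_mat_def)
      qed (simp add: strand_map_cell_resolution_Suc b(2) to_cells_enum)
      then have "a = strand_map \<F> (Suc i) b'" by auto
      ultimately show ?thesis by blast
    qed
  next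
    assume "a \<in> strand_map \<F> (Suc i) ` strand_chains \<F> (Suc (Suc i)) c"
    then obtain b where b: "b \<in> strand_chains \<F> (Suc (Suc i)) c" "a = strand_map \<F> (Suc i) b" by auto
    have a: "a \<in> strand_chains \<F> (Suc i) c"
      unfolding b(2) by (rule filtered_linearD(3)[OF strand_map_linear b(1)])
    have tc: "to_cells i a = cell_diff L (to_cells (Suc i) b)"
      unfolding b(2) by (rule to_cells_strand_map[OF b(1)])
    have "strand_map \<F> i a = 0"
      unfolding strand_map_cell_resolution_eq_0_iff[OF a] tc by (simp add: cell_aug_diff cell_diff_diff)
    with a show "a \<in> {a \<in> strand_chains \<F> (Suc i) c. strand_map \<F> i a = 0}" by simp
  }
qed

lemma augm_image_cell_resolution:
  "augm_map \<F> ` free_module (num_gens \<F> 0) = (hibi_ideal L :: ('n vertex, 'k::comm_ring_1) mpoly set)"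
proof -
  interpret ring_module: module "(*) :: ('n vertex, 'k) mpoly \<Rightarrow> _"
    by unfold_locales (simp_all add: algebra_simps)
  let ?F = "\<F> :: ('n vertex, 'k) free_complex"
  let ?n = "card (dim_cells L 0)"
  have augm: "augm ?F j \<in> cover_monomial ` L" if j: "j < ?n" for j
  proof -
    obtain p where "p \<in> L" "enum_cell L 0 j = (p, {})"
      using enum_cell_in[OF j] by (auto simp: dim_cells_def cells_def)
    then show ?thesis by (auto simp: cell_resolution_def cover_monomial_eq cell_degree_cover)
  qed
  have "augm_map ?F ` free_module ?n \<subseteq> ring_module.span (cover_monomial ` L)"
    unfolding augm_map_def cell_resolution_simps
  proof clarify
    fix f :: "nat \<Rightarrow> ('n vertex, 'k) mpoly"
    have "f j * augm ?F j \<in> ring_module.span (cover_monomial ` L)" if "j < ?n" for j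
      by (intro ring_module.span_scale ring_module.span_base augm that)
    then show "(\<Sum>j<?n. augm ?F j * f j) \<in> ring_module.span (cover_monomial ` L)"
      by (intro ring_module.span_sum) (simp add: mult.commute)
  qed
  moreover have "ring_module.span (cover_monomial ` L) \<subseteq> augm_map ?F ` free_module ?n"
  proof (rule ring_module.span_minimal)
    show "cover_monomial ` L \<subseteq> augm_map ?F ` free_module ?n"
    proof
      fix u :: "('n vertex, 'k) mpoly" assume "u \<in> cover_monomial ` L"
      then obtain p where p: "p \<in> L" "u = cover_monomial p" by auto
      then have "(p, {}) \<in> dim_cells L 0" by (simp add: dim_cells_def cells_def)
      then obtain j where j: "j < ?n" "enum_cell L 0 j = (p, {})"
        by (metis dim_cells_enumE)
      then have u: "augm ?F j = u" by (simp add: p(2) cell_resolution_def cover_monomial_eq cell_degree_cover)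
      have "augm_map ?F (unit_chain j) = (\<Sum>l<?n. if l = j then augm ?F l else 0)"
        unfolding augm_map_def cell_resolution_simps by (rule sum.cong) (auto simp: unit_chain_def)
      then have "u = augm_map ?F (unit_chain j)" using j(1) u by simp
      moreover have "unit_chain j \<in> free_module ?n" using j(1) by (auto simp: free_module_def unit_chain_def)
      ultimately show "u \<in> augm_map ?F ` free_module ?n" by blast
    qed
    show "ring_module.subspace (augm_map ?F ` free_module ?n)"
    proof (rule ring_module.subspaceI)
      show "0 \<in> augm_map ?F ` free_module ?n"
        by (rule image_eqI[of _ _ 0]) (simp_all add: augm_map_def free_module_def)
      show "x + y \<in> augm_map ?F ` free_module ?n"
        if xy: "x \<in> augm_map ?F ` free_module ?n" "y \<in> augm_map ?F ` free_module ?n" for x y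
      proof -
        obtain f g where fg: "f \<in> free_module ?n" "g \<in> free_module ?n" "x = augm_map ?F f" "y = augm_map ?F g"
          using xy by auto
        then show ?thesis
          by (intro image_eqI[of _ _ "f + g"]) (auto simp: augm_map_def free_module_def sum.distrib algebra_simps)
      qed
      show "r * x \<in> augm_map ?F ` free_module ?n" if x: "x \<in> augm_map ?F ` free_module ?n" for r x
      proof -
        obtain f where f: "f \<in> free_module ?n" "x = augm_map ?F f" using x by blast
        have "r * x = augm_map ?F (\<lambda>j. r * f j)"
          unfolding f(2) augm_map_def sum_distrib_left by (intro sum.cong refl) (rule mult.left_commute)
        moreover have "(\<lambda>j. r * f j) \<in> free_module ?n" using f(1) by (simp add: free_module_def)
        ultimately show ?thesis by blast
      qed
    qed
  qed
  ultimately show ?thesis by (simp add: hibi_ideal_def ideal_generated_def)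
qed

lemma multigraded_free_resolution_cell_resolution:
  "multigraded_free_resolution \<F> (hibi_ideal L :: ('n vertex, 'k::comm_ring_1) mpoly set)"
  by (rule resolution_of_strand_exact[OF homogeneous_cell_resolution strand_exact_cell_resolution
    augm_image_cell_resolution])

text \<open>Minimality: a nonzero incidence number joins cells of different degrees, so the
  corresponding entry has no constant term.\<close>

lemma tensor_diff_cell_resolution:
  fixes a :: "nat \<Rightarrow> 'k::field"
  shows "tensor_diff \<F> i a = 0"
proof -
  let ?F = "\<F> :: ('n vertex, 'k) free_complex"
  have "Poly_Mapping.lookup (diff_mat ?F i k j) 0 = 0" if j: "j < num_gens ?F (Suc i)" for k j
  proof -
    let ?x = "enum_cell L (Suc i) j" and ?y = "enum_cell L i k"
    have x: "?x \<in> cells L" using enum_cell_in[of j L "Suc i"] j by (simp add: dim_cells_def)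
    have eq: "Poly_Mapping.lookup (diff_mat ?F i k j) 0 =
        (if cell_degree ?x - cell_degree ?y = 0 then cell_bd ?x ?y else 0)"
      unfolding cell_resolution_def
      by (simp add: homogeneous_lookup_zero[OF homogeneous_monomial_term] coef_monomial_term)
    show ?thesis
    proof (cases "cell_bd ?x ?y = (0::'k)")
      case False
      then have "cell_degree ?y \<noteq> cell_degree ?x" by (rule cell_bd_degree(2)[OF x])
      then show ?thesis using eq by simp
    qed (simp add: eq)
  qed
  then show ?thesis by (auto simp: tensor_diff_def apply_mat_def)
qed

text \<open>With vanishing differentials the homology in degree \<open>b\<close> is spanned by the
  generators of that degree, so it is nonzero exactly when there is one.\<close>

theorem betti_hibi_ideal_nonzero_iff:
  "betti (hibi_ideal L :: ('n vertex, 'k::field) mpoly set) i b \<noteq> 0 \<longleftrightarrow>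
    (\<exists>x\<in>cells L. card (snd x) = i \<and> cell_degree x = b)"
proof -
  let ?F = "\<F> :: ('n vertex, 'k) free_complex"
  have cyc: "tensor_cycles ?F i b = degree_chains (card (dim_cells L i)) (\<lambda>j. cell_degree (enum_cell L i j)) b"
    unfolding tensor_cycles_def tensor_diff_cell_resolution tensor_chains_eq
    by (auto split: nat.split)
  have bd: "tensor_boundaries ?F i b = {0}"
    unfolding tensor_boundaries_def tensor_diff_cell_resolution
    using chain_space.subspace_0[OF subspace_degree_chains] by (auto simp: tensor_chains_eq)
  have "tensor_cycles ?F i b \<noteq> {0} \<longleftrightarrow> (\<exists>j<card (dim_cells L i). cell_degree (enum_cell L i j) = b)"
  proof
    assume "tensor_cycles ?F i b \<noteq> {0}"
    then obtain a where "a \<in> tensor_cycles ?F i b" "a \<noteq> 0"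
      using chain_space.subspace_0[OF subspace_degree_chains] unfolding cyc by blast
    then show "\<exists>j<card (dim_cells L i). cell_degree (enum_cell L i j) = b"
      unfolding cyc by (auto simp: degree_chains_def fun_eq_iff)
  next
    assume "\<exists>j<card (dim_cells L i). cell_degree (enum_cell L i j) = b"
    then obtain j where j: "j < card (dim_cells L i)" "cell_degree (enum_cell L i j) = b" by blast
    then have "unit_chain j \<in> tensor_cycles ?F i b" unfolding cyc by (auto simp: degree_chains_def unit_chain_def)
    moreover have "unit_chain j \<noteq> (0 :: nat \<Rightarrow> 'k)" by (auto simp: unit_chain_def fun_eq_iff)
    ultimately show "tensor_cycles ?F i b \<noteq> {0}" by blast
  qed
  also have "\<dots> \<longleftrightarrow> (\<exists>x\<in>dim_cells L i. cell_degree x = b)"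
    by (metis dim_cells_enumE enum_cell_in)
  also have "\<dots> \<longleftrightarrow> (\<exists>x\<in>cells L. card (snd x) = i \<and> cell_degree x = b)"
    unfolding dim_cells_def by blast
  finally show ?thesis
    unfolding betti_nonzero_iff[OF multigraded_free_resolution_cell_resolution] bd .
qed

end


section \<open>Extremal Betti numbers\<close>

context set_lattice begin

lemma cell_eq_of_degree_le:
  assumes "x \<in> cells L" "y \<in> cells L" "cell_degree x \<le> cell_degree y"
  shows "snd x \<subseteq> snd y" "card (snd y) \<le> card (snd x) \<Longrightarrow> x = y"
proof -
  have le: "fst x \<subseteq> fst y" "fst y - \<Union>(snd y) \<subseteq> fst x - \<Union>(snd x)"
    using assms(3) by (simp_all only: cell_degree_le_iff)
  show "snd x \<subseteq> snd y"
    using cell_subset[of "fst x" "snd x" "fst y" "snd y"] assms(1,2) le by simp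
  show "x = y" if "card (snd y) \<le> card (snd x)"
  proof -
    have "(fst x, snd x) \<in> cells L" "(fst y, snd y) \<in> cells L" using assms(1,2) by simp_all
    from cell_eqI[OF this le that] show ?thesis by (rule prod_eqI)
  qed
qed

text \<open>A y-exponent of the least common multiple is 0 exactly when its label lies in
  \<open>p\<close> and all lower neighbors, that is, in the bottom of the full cell. The x-exponents
  are those of \<open>p\<close>, because lower neighbors are smaller.\<close>

lemma lcm_multideg_eq: "lcm_multideg L p = cell_degree (p, blocks L p)"
proof
  fix v
  let ?N = "lower_neighbors L p"
  have sub: "q \<subseteq> p" if "q \<in> ?N" for q using lower_neighborsD(2)[OF that] by blast
  have bot: "j \<in> p - \<Union>(blocks L p) \<longleftrightarrow> (\<forall>q\<in>insert p ?N. j \<in> q)" for j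
    using sub unfolding blocks_def by blast
  have fin: "finite ((\<lambda>q. cover_multideg q v) ` insert p ?N)" by simp
  show "lcm_multideg L p v = cell_degree (p, blocks L p) v"
    unfolding lcm_multideg_def
  proof (rule Max_eqI[OF fin])
    fix z assume "z \<in> (\<lambda>q. cover_multideg q v) ` insert p ?N"
    then obtain q where q: "q \<in> insert p ?N" "z = cover_multideg q v" by blast
    have "q \<subseteq> p" using q(1) sub by blast
    moreover have "j \<in> p - \<Union>(blocks L p) \<Longrightarrow> j \<in> q" for j using q(1) bot by blast
    ultimately show "z \<le> cell_degree (p, blocks L p) v"
      unfolding q(2) by (cases v) (auto simp: cover_multideg_def cell_degree_def)
  next
    show "cell_degree (p, blocks L p) v \<in> (\<lambda>q. cover_multideg q v) ` insert p ?N"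
    proof (cases v)
      case (Inl i)
      then show ?thesis by (auto simp: cover_multideg_def cell_degree_def)
    next
      case (Inr j)
      show ?thesis
      proof (cases "j \<in> p - \<Union>(blocks L p)")
        case True
        then show ?thesis using Inr by (auto simp: cover_multideg_def cell_degree_def)
      next
        case False
        then obtain q where "q \<in> insert p ?N" "j \<notin> q" using bot by blast
        moreover from this have "cell_degree (p, blocks L p) v = cover_multideg q v"
          using False Inr by (simp add: cover_multideg_def cell_degree_def)
        ultimately show ?thesis by blast
      qed
    qed
  qed
qed

lemma i_extremal_hibi_ideal:
  fixes H :: "('n vertex, 'k::field) mpoly set"
  assumes "H = hibi_ideal L" "betti H i b \<noteq> 0"
  shows "i_extremal H i b"
  unfolding i_extremal_def
proof (intro conjI allI impI)
  note nz = betti_hibi_ideal_nonzero_iff[where ?'k = 'k, folded assms(1)]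
  show "betti H i b \<noteq> 0" by fact
  fix c assume "c > b"
  show "betti H i c = 0"
  proof (rule ccontr)
    assume "betti H i c \<noteq> 0"
    then obtain y where y: "y \<in> cells L" "card (snd y) = i" "cell_degree y = c" using nz by blast
    obtain x where x: "x \<in> cells L" "card (snd x) = i" "cell_degree x = b" using nz assms(2) by blast
    have "x = y"
      by (rule cell_eq_of_degree_le(2)[OF x(1) y(1)]) (use x y \<open>c > b\<close> in auto)
    then show False using x y \<open>c > b\<close> by simp
  qed
qed

lemma extremal_hibi_ideal_iff:
  fixes H :: "('n vertex, 'k::field) mpoly set"
  assumes "H = hibi_ideal L"
  shows "extremal H i b \<longleftrightarrow>
    (\<exists>p\<in>max_boolean_tops L. i = card (lower_neighbors L p) \<and> b = lcm_multideg L p)"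
proof
  note nz = betti_hibi_ideal_nonzero_iff[where ?'k = 'k, folded assms(1)]
  {
    assume ext: "extremal H i b"
    then obtain x where x: "x \<in> cells L" "card (snd x) = i" "cell_degree x = b"
      using nz unfolding extremal_def by blast
    \<comment> \<open>A cell of strictly larger degree has at least the dimension of
      \<open>x\<close>, and its surplus of dimension is bounded by its surplus of total degree.
      Extremality would make its nonzero Betti number vanish.\<close>
    have max: "y = x" if y: "y \<in> cells L" "cell_degree x \<le> cell_degree y" for y
    proof (rule ccontr)
      assume "y \<noteq> x"
      have sub: "snd x \<subseteq> snd y" by (rule cell_eq_of_degree_le(1)[OF x(1) y])
      then have "card (snd x) \<le> card (snd y)" by (simp add: card_mono)
      have "cell_degree y \<noteq> cell_degree x"
      proof
        assume eq: "cell_degree y = cell_degree x"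
        then have "snd y \<subseteq> snd x" using cell_eq_of_degree_le(1)[OF y(1) x(1)] by simp
        then have "x = y" using cell_eq_of_degree_le(2)[OF x(1) y] by (simp add: card_mono)
        then show False using \<open>y \<noteq> x\<close> by simp
      qed
      then have "cell_degree y > b" using y(2) x(3) by auto
      moreover have "sum (cell_degree y) UNIV - sum b UNIV \<ge> int (card (snd y)) - int i"
        using card_diff_le_card_Union[of "fst y" "snd y" "snd x"] y(1) sub x(2)
        by (simp add: sum_cell_degree[OF y(1)] sum_cell_degree[OF x(1)] flip: x(3))
      ultimately have "betti H (card (snd y)) (cell_degree y) = 0"
        using ext \<open>card (snd x) \<le> card (snd y)\<close> x(2) unfolding extremal_def by blast
      moreover have "betti H (card (snd y)) (cell_degree y) \<noteq> 0" using nz y(1) by blast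
      ultimately show False by simp
    qed
    obtain p T where pT: "x = (p, T)" by (cases x)
    then have p: "p \<in> L" "T \<subseteq> blocks L p" using x(1) by (auto simp: cells_def)
    \<comment> \<open>Adding the remaining blocks of \<open>p\<close> only lowers the bottom, so
      maximality forces all blocks to occur in \<open>T\<close>.\<close>
    have "cell_degree x \<le> cell_degree (p, blocks L p)"
      using p(2) unfolding pT cell_degree_le_iff fst_conv snd_conv by blast
    then have T: "T = blocks L p" using max[OF top_cell[OF p(1)]] pT by simp
    have "p \<in> max_boolean_tops L"
      unfolding max_boolean_tops_iff
    proof (intro conjI p(1) allI impI)
      fix p' T' assume y: "(p', T') \<in> cells L" "p \<subseteq> p'" "p' - \<Union>T' \<subseteq> p - \<Union>(blocks L p)"
      then have "(p', T') = x"
        by (intro max) (simp_all only: pT T cell_degree_le_iff fst_conv snd_conv simp_thms)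
      then show "p' = p" "p' - \<Union>T' = p - \<Union>(blocks L p)" using pT T by simp_all
    qed
    moreover have "i = card (lower_neighbors L p)" using x(2) pT T by (simp add: card_blocks)
    moreover have "b = lcm_multideg L p" using x(3) pT T by (simp add: lcm_multideg_eq)
    ultimately show "\<exists>p\<in>max_boolean_tops L. i = card (lower_neighbors L p) \<and> b = lcm_multideg L p"
      by blast
  next
    assume "\<exists>p\<in>max_boolean_tops L. i = card (lower_neighbors L p) \<and> b = lcm_multideg L p"
    then obtain p where p: "p \<in> max_boolean_tops L" "i = card (blocks L p)" "b = cell_degree (p, blocks L p)"
      by (auto simp: card_blocks lcm_multideg_eq)
    have pL: "p \<in> L" using p(1) by (simp add: max_boolean_tops_iff)
    have "betti H i b \<noteq> 0" unfolding nz using top_cell[OF pL] p(2,3) by force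
    \<comment> \<open>By maximality of the interval below \<open>p\<close>, no cell of any dimension
      has a degree above \<open>b\<close>.\<close>
    moreover have "betti H j c = 0" if "c > b" for j c
    proof (rule ccontr)
      assume "betti H j c \<noteq> 0"
      then obtain y where y: "y \<in> cells L" "cell_degree y = c" using nz by blast
      obtain p' T' where p'T': "y = (p', T')" by (cases y)
      have "b \<le> cell_degree y" "b \<noteq> cell_degree y" using that y(2) by auto
      then have le: "p \<subseteq> p'" "p' - \<Union>T' \<subseteq> p - \<Union>(blocks L p)"
        unfolding p(3) p'T' cell_degree_le_iff by simp_all
      have "p' = p \<and> p' - \<Union>T' = p - \<Union>(blocks L p)"
        using p(1) y(1) le unfolding p'T' max_boolean_tops_iff by blast
      then have "p' \<subseteq> p" "p - \<Union>(blocks L p) \<subseteq> p' - \<Union>T'"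
        by (blast, elim conjE equalityD2)
      then have "cell_degree y \<le> b"
        unfolding p(3) p'T' cell_degree_le_iff fst_conv snd_conv by (rule conjI)
      with \<open>b \<le> cell_degree y\<close> \<open>b \<noteq> cell_degree y\<close> show False by (simp add: order.antisym)
    qed
    ultimately show "extremal H i b" unfolding extremal_def by blast
  }
qed

end

text \<open>Unmixedness forces a minimal cover to contain exactly one vertex of each matched pair,
  so it is given by its x-part \<open>p\<close>. Covering the edge of \<open>xv i\<close> and
  \<open>yv j\<close> then says that \<open>j \<in> p\<close> implies
  \<open>i \<in> p\<close>.\<close>

lemma cover_lattice_eq:
  fixes E :: "'n::finite vertex set set"
  assumes bip: "bipartition E (range xv) (range yv)" and "unmixed E"
    and match: "\<And>i. {xv i, yv i} \<in> E"
  shows "cover_lattice E = {p. \<forall>i j. {xv i, yv j} \<in> E \<longrightarrow> i \<in> p \<or> j \<notin> p}"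
proof -
  have pair: "xv i \<in> C \<or> yv i \<in> C" if "vertex_cover E C" for i C
    using bspec[OF that[unfolded vertex_cover_def] match[of i]] by auto
  have minI: "minimal_vertex_cover E C"
    if C: "vertex_cover E C" and one: "\<And>i. \<not> (xv i \<in> C \<and> yv i \<in> C)" for C
    unfolding minimal_vertex_cover_def
  proof (intro conjI C allI impI notI)
    fix D assume D: "D \<subset> C" "vertex_cover E D"
    then obtain v where v: "v \<in> C" "v \<notin> D" by blast
    show False
    proof (cases v)
      case (Inl i)
      then show False using pair[OF D(2), of i] one[of i] v D(1) by blast
    next
      case (Inr i)
      then show False using pair[OF D(2), of i] one[of i] v D(1) by blast
    qed
  qed
  have edge: "\<exists>i j. e = {xv i, yv j}" if "e \<in> E" for e
    using bspec[OF conjunct2[OF conjunct2[OF bip[unfolded bipartition_def]]] that] by blast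
  \<comment> \<open>The x-vertices form a minimal cover with one vertex per label; by unmixedness
    this fixes the size of every minimal cover.\<close>
  have "vertex_cover E (range xv)"
    unfolding vertex_cover_def
  proof
    fix e assume "e \<in> E"
    then obtain i j where "e = {xv i, yv j}" using edge by blast
    then show "e \<inter> range xv \<noteq> {}" by blast
  qed
  then have X: "minimal_vertex_cover E (range xv)" by (rule minI) auto
  have exact: "\<not> (xv i \<in> C \<and> yv i \<in> C)" if C: "minimal_vertex_cover E C" for C i
  proof
    assume i: "xv i \<in> C \<and> yv i \<in> C"
    have cov: "vertex_cover E C" using C by (simp add: minimal_vertex_cover_def)
    have "card C = card (range xv :: 'n vertex set)"
      using assms(2) C X unfolding unmixed_def by blast
    then have "card C = card (UNIV :: 'n set)" by (simp add: card_image)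
    \<comment> \<open>If both ends of a matched pair were in \<open>C\<close>, dropping
      \<open>yv i\<close> would still leave a vertex for every label, so \<open>C\<close> would be
      too large.\<close>
    moreover have "card (UNIV :: 'n set) \<le> card (C - {yv i})"
    proof -
      have "(UNIV :: 'n set) \<subseteq> (\<lambda>v. case v of Inl i \<Rightarrow> i | Inr i \<Rightarrow> i) ` (C - {yv i})"
      proof
        fix j
        consider "xv j \<in> C - {yv i}" | "yv j \<in> C - {yv i}" using pair[OF cov, of j] i by auto
        then show "j \<in> (\<lambda>v. case v of Inl i \<Rightarrow> i | Inr i \<Rightarrow> i) ` (C - {yv i})" by cases force+
      qed
      then show ?thesis by (rule surj_card_le[rotated]) simp
    qed
    moreover have "card (C - {yv i}) < card C" using i by (meson card_Diff1_less finite)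
    ultimately show False by simp
  qed
  show ?thesis
  proof (intro equalityI subsetI)
    fix p assume "p \<in> cover_lattice E"
    then obtain C where C: "minimal_vertex_cover E C" "p = {i. xv i \<in> C}"
      unfolding cover_lattice_def by blast
    have "i \<in> p \<or> j \<notin> p" if "{xv i, yv j} \<in> E" for i j
    proof -
      have "xv i \<in> C \<or> yv j \<in> C"
        using bspec[OF conjunct1[OF C(1)[unfolded minimal_vertex_cover_def vertex_cover_def]] that] by auto
      then show ?thesis using exact[OF C(1), of j] C(2) by blast
    qed
    then show "p \<in> {p. \<forall>i j. {xv i, yv j} \<in> E \<longrightarrow> i \<in> p \<or> j \<notin> p}" by blast
  next
    fix p assume p: "p \<in> {p. \<forall>i j. {xv i, yv j} \<in> E \<longrightarrow> i \<in> p \<or> j \<notin> p}"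
    let ?C = "xv ` p \<union> yv ` (- p)"
    have "vertex_cover E ?C"
      unfolding vertex_cover_def
    proof
      fix e assume "e \<in> E"
      then obtain i j where "e = {xv i, yv j}" using edge by blast
      then show "e \<inter> ?C \<noteq> {}" using p \<open>e \<in> E\<close> by blast
    qed
    then have "minimal_vertex_cover E ?C" by (rule minI) auto
    moreover have "p = {i. xv i \<in> ?C}" by auto
    ultimately show "p \<in> cover_lattice E" unfolding cover_lattice_def by blast
  qed
qed

theorem corollary1p7:
  fixes E :: "'n::finite vertex set set"
    and H :: "('n vertex, 'k::field) mpoly set"
  assumes "simple_graph E"
    and "no_isolated_vertices E"
    and "bipartition E (range xv) (range yv)"
    and "unmixed E"
    and "\<And>i. {xv i, yv i} \<in> E"
    and "H = hibi_ideal (cover_lattice E)"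
  shows "(\<forall>i b. betti H i b \<noteq> 0 \<longrightarrow> i_extremal H i b) \<and>
    (\<forall>i b. extremal H i b \<longleftrightarrow>
      (\<exists>p \<in> max_boolean_tops (cover_lattice E).
        i = card (lower_neighbors (cover_lattice E) p) \<and> b = lcm_multideg (cover_lattice E) p))"
proof -
  \<comment> \<open>Implications between memberships of single labels survive unions and
    intersections.\<close>
  interpret set_lattice "cover_lattice E"
    unfolding cover_lattice_eq[OF assms(3-5)] by unfold_locales blast+
  show ?thesis
    using i_extremal_hibi_ideal[OF assms(6)] extremal_hibi_ideal_iff[OF assms(6)] by blast
qed

end
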